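(* Let $q > 1$ be an odd integer and let $\Gamma$ be a primitive strongly regular graph with $v = (q+1)(q^2-q+1)$ vertices, valency $k$, eigenvalues $e^+ = \frac{q-1}{2}$ and $e^- = -\frac{q^2+1}{2}$, where the multiplicity $m^-$ of $e^-$ satisfies $ve^- = m^-(e^- - k)$. Then $\Gamma$ does not possess a Delsarte coclique if one of the following holds: (a) $q \equiv 5 \pmod 8$; or (b) $q = 2\ell p^e + 1$, where $p$ is a prime with $p \equiv 3 \pmod 4$, $e$ is a positive odd integer, $\ell$ is odd, and $\gcd(\ell,p) = 1$. Furthermore, if $q > 3$, then $\Gamma$ possesses at most two Delsarte cocliques.
   Context: A strongly regular graph with parameters $(v,k,\lambda,\mu)$ has $v$ vertices, is $k$-regular, two adjacent vertices have $\lambda$ common neighbours and two distinct non-adjacent vertices have $\mu$ common neighbours; its adjacency matrix has eigenvalues $k \ge e^+ \ge 0 > e^-$, and $m^-$ is the multiplicity of $e^-$. Primitive means the graph and its complement are connected. A Delsarte coclique is a set of pairwise non-adjacent vertices of size $\frac{ve^-}{e^- - k}$. *)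

theory Defs
  imports "Jordan_Normal_Form.Char_Poly"
begin

definition simple_graph :: "nat \<Rightarrow> (nat \<Rightarrow> nat \<Rightarrow> bool) \<Rightarrow> bool" where
  "simple_graph v E \<longleftrightarrow>
     (\<forall>x y. E x y \<longrightarrow> x < v \<and> y < v) \<and>
     (\<forall>x y. E x y \<longrightarrow> E y x) \<and> (\<forall>x. \<not> E x x)"

definition nbrs :: "nat \<Rightarrow> (nat \<Rightarrow> nat \<Rightarrow> bool) \<Rightarrow> nat \<Rightarrow> nat set" where
  "nbrs v E x = {y. y < v \<and> E x y}"

definition strongly_regular ::
  "nat \<Rightarrow> (nat \<Rightarrow> nat \<Rightarrow> bool) \<Rightarrow> nat \<Rightarrow> nat \<Rightarrow> nat \<Rightarrow> bool" where
  "strongly_regular v E k lam mu \<longleftrightarrow>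
     simple_graph v E \<and>
     (\<forall>x<v. card (nbrs v E x) = k) \<and>
     (\<forall>x<v. \<forall>y<v. E x y \<longrightarrow> card (nbrs v E x \<inter> nbrs v E y) = lam) \<and>
     (\<forall>x<v. \<forall>y<v. x \<noteq> y \<and> \<not> E x y \<longrightarrow> card (nbrs v E x \<inter> nbrs v E y) = mu)"

definition complement_graph :: "nat \<Rightarrow> (nat \<Rightarrow> nat \<Rightarrow> bool) \<Rightarrow> nat \<Rightarrow> nat \<Rightarrow> bool" where
  "complement_graph v E x y \<longleftrightarrow> x < v \<and> y < v \<and> x \<noteq> y \<and> \<not> E x y"

definition connected_graph :: "nat \<Rightarrow> (nat \<Rightarrow> nat \<Rightarrow> bool) \<Rightarrow> bool" where
  "connected_graph v E \<longleftrightarrow> (\<forall>x<v. \<forall>y<v. E\<^sup>*\<^sup>* x y)"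

definition primitive_srg :: "nat \<Rightarrow> (nat \<Rightarrow> nat \<Rightarrow> bool) \<Rightarrow> bool" where
  "primitive_srg v E \<longleftrightarrow> connected_graph v E \<and> connected_graph v (complement_graph v E)"

definition adj_matrix :: "nat \<Rightarrow> (nat \<Rightarrow> nat \<Rightarrow> bool) \<Rightarrow> real mat" where
  "adj_matrix v E = mat v v (\<lambda>(i,j). if E i j then 1 else 0)"

text \<open>Multiplicity of an eigenvalue: its multiplicity as a root of the characteristic polynomial
  (equal to the geometric multiplicity, as the adjacency matrix is symmetric).\<close>
definition eig_mult :: "real mat \<Rightarrow> real \<Rightarrow> nat" where
  "eig_mult A e = order e (char_poly A)"

definition coclique :: "nat \<Rightarrow> (nat \<Rightarrow> nat \<Rightarrow> bool) \<Rightarrow> nat set \<Rightarrow> bool" where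
  "coclique v E C \<longleftrightarrow> C \<subseteq> {..<v} \<and> (\<forall>x\<in>C. \<forall>y\<in>C. \<not> E x y)"

definition delsarte_coclique ::
  "nat \<Rightarrow> (nat \<Rightarrow> nat \<Rightarrow> bool) \<Rightarrow> nat \<Rightarrow> real \<Rightarrow> nat set \<Rightarrow> bool" where
  "delsarte_coclique v E k em C \<longleftrightarrow>
     coclique v E C \<and> real (card C) = real v * em / (em - real k)"

end

(* Let r = (q - 1) / 2 and kap = (q^2 + 1) / 2.  The eigenvalue and multiplicity conditions force
   k = q kap, mu = kap (r + 1) and lam = mu + r - kap, and then a Delsarte coclique C has
   c = q^2 - q + 1 vertices.  The vertices outside C are the blocks of a quasi-symmetric 2-design on C
   with block size kap: two of them meet in (r + 1)^2 - r or (r + 1)^2 points according to whether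
   they are adjacent or not.

   Uniqueness: for a second Delsarte coclique C', the blocks in C' - C form a symmetric design on
   C - C', which forces q + 1 to divide 4.

   Nonexistence: let m = 2 in case (a) and m = p^e in case (b).  Extend each block by a coordinate
   r + 1 and give that coordinate the sign -1.  Modulo m the extended blocks span a self-dual code for
   the form x_1^2 + ... + x_c^2 - s^2.  Summing a quadratic character over all of (Z/m)^(c+1) along
   cosets of this code shows that g^c * cnj g is a positive integer, where g is the quadratic Gauss
   sum.  But g^(c-1) is negative: c - 1 is 4 mod 8 and g^4 = (1 + i)^4 = -4 in case (a), while
   c - 1 is 2 mod 4 and g^2 = -m in case (b). *)
theory Submission
  imports Defs "HOL-Number_Theory.Residues" "Jordan_Normal_Form.Schur_Decomposition"
begin

section \<open>Gauss sums\<close>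

lemma periodic_int_mult:
  fixes f :: "int \<Rightarrow> 'a"
  assumes per: "\<And>t. f (t + m) = f t"
  shows "f (t + m * k) = f t"
proof (induction k rule: int_induct[where k = 0])
  case (step1 i)
  then show ?case using per[of "t + m * i"] by (simp add: algebra_simps)
next
  case (step2 i)
  then show ?case using per[of "t + m * (i - 1)"] by (simp add: algebra_simps)
qed simp

lemma sum_periodic_shift:
  fixes f :: "int \<Rightarrow> 'a::comm_monoid_add"
  assumes per: "\<And>t. f (t + m) = f t" and "m > 0"
  shows "(\<Sum>t\<in>{0..<m}. f (t + d)) = (\<Sum>t\<in>{0..<m}. f t)"
proof (rule sum.reindex_bij_witness[where i = "\<lambda>t. (t - d) mod m" and j = "\<lambda>t. (t + d) mod m"])
  fix t assume t: "t \<in> {0..<m}"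
  have "f (t + d) = f ((t + d) mod m + m * ((t + d) div m))" by simp
  also have "\<dots> = f ((t + d) mod m)" by (rule periodic_int_mult[where f = f and m = m, OF per])
  finally show "f ((t + d) mod m) = f (t + d)" by simp
qed (use \<open>m > 0\<close> in \<open>auto simp: mod_simps\<close>)

text \<open>Shifting t by 1 multiplies the sum by \<omega>^(2u), so the sum vanishes unless this
  factor is 1. Only the order of \<omega>^2 is prescribed, which covers both \<omega> of odd order m
  and the case m = 2 with \<omega> = i.\<close>

lemma sum_powi_linear:
  fixes \<omega> :: complex
  assumes "m > 0" and ord: "\<And>j. \<omega> powi (2 * j) = 1 \<longleftrightarrow> m dvd j"
  shows "(\<Sum>t\<in>{0..<m}. \<omega> powi (2 * (t * u))) = (if m dvd u then of_int m else 0)"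
proof (cases "m dvd u")
  case True
  then have "\<omega> powi (2 * (t * u)) = 1" for t by (simp only: ord dvd_mult)
  then show ?thesis using True \<open>m > 0\<close> by (simp only:) simp
next
  case False
  have "\<omega> \<noteq> 0" using ord[of m] \<open>m > 0\<close> by auto
  let ?f = "\<lambda>t. \<omega> powi (2 * (t * u))"
  have per: "?f (t + m) = ?f t" for t
  proof -
    have "?f (t + m) = ?f t * \<omega> powi (2 * (m * u))"
      using \<open>\<omega> \<noteq> 0\<close> by (simp add: algebra_simps flip: power_int_add)
    then show ?thesis using ord[of "m * u"] by simp
  qed
  have "(\<Sum>t\<in>{0..<m}. ?f t) = (\<Sum>t\<in>{0..<m}. ?f (t + 1))"
    by (rule sum_periodic_shift[where f = ?f, OF per \<open>m > 0\<close>, symmetric])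
  also have "\<dots> = (\<Sum>t\<in>{0..<m}. ?f t) * \<omega> powi (2 * u)"
    using \<open>\<omega> \<noteq> 0\<close> by (simp add: algebra_simps sum_distrib_left flip: power_int_add)
  finally show ?thesis using ord[of u] False by simp
qed

lemma prod_powi:
  fixes \<omega> :: "'a::field"
  assumes "\<omega> \<noteq> 0"
  shows "(\<Prod>p\<in>P. \<omega> powi f p) = \<omega> powi (\<Sum>p\<in>P. f p)"
  using assms by (induction P rule: infinite_finite_induct) (auto simp: power_int_add)

text \<open>The columns of \<open>M\<close>, indexed by \<open>B\<close>, generate a code in (Z/m)^P
  carrying the diagonal form with coefficients \<open>\<epsilon>\<close>. Translating by a code word
  permutes (Z/m)^P, so averaging over all translates leaves the Gauss sum unchanged. After
  expansion, isotropy removes the value of the form on the code, and orthogonality keeps only the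
  vectors of the dual code, each with weight 1 by \<open>self_dual\<close>. Hence the product of
  Gauss sums is the size of the dual code.\<close>

lemma gauss_sum_product_self_dual:
  fixes \<omega> :: complex and M :: "'p \<Rightarrow> 'b \<Rightarrow> int" and \<epsilon> :: "'p \<Rightarrow> int"
  assumes "finite P" "finite B" "m > 0"
    and ord: "\<And>j. \<omega> powi (2 * j) = 1 \<longleftrightarrow> m dvd j"
    and sq: "\<omega> powi (m\<^sup>2) = 1"
    and isotropic: "\<And>z. \<omega> powi (\<Sum>p\<in>P. \<epsilon> p * (\<Sum>y\<in>B. M p y * z y)\<^sup>2) = 1"
    and self_dual: "\<And>x. (\<forall>y\<in>B. m dvd (\<Sum>p\<in>P. \<epsilon> p * M p y * x p)) \<Longrightarrow> \<omega> powi (\<Sum>p\<in>P. \<epsilon> p * (x p)\<^sup>2) = 1"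
  shows "\<exists>N>0. (\<Prod>p\<in>P. \<Sum>t\<in>{0..<m}. \<omega> powi (\<epsilon> p * t\<^sup>2)) = of_nat N"
proof -
  have "\<omega> \<noteq> 0" using ord[of m] \<open>m > 0\<close> by auto
  define X where "X = (P \<rightarrow>\<^sub>E {0..<m})"
  define Z where "Z = (B \<rightarrow>\<^sub>E {0..<m})"
  define G where "G = (\<Prod>p\<in>P. \<Sum>t\<in>{0..<m}. \<omega> powi (\<epsilon> p * t\<^sup>2))"
  define Mz where "Mz z p = (\<Sum>y\<in>B. M p y * z y)" for z p
  define u where "u x y = (\<Sum>p\<in>P. \<epsilon> p * M p y * x p)" for x y
  define D where "D = {x\<in>X. \<forall>y\<in>B. m dvd u x y}"
  have fin: "finite X" "finite Z" unfolding X_def Z_def using assms by (auto intro: finite_PiE)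
  \<comment> \<open>The order of \<omega> need not be m, so periodicity has two sources:
    \<open>ord\<close> kills the cross term 2amt, and \<open>sq\<close> kills a m^2.\<close>
  have per: "\<omega> powi (a * (t + m)\<^sup>2) = \<omega> powi (a * t\<^sup>2)" for a t
  proof -
    have "\<omega> powi (a * (t + m)\<^sup>2) = \<omega> powi (a * t\<^sup>2) * \<omega> powi (2 * (m * (a * t))) * (\<omega> powi (m\<^sup>2)) powi a"
      using \<open>\<omega> \<noteq> 0\<close> by (simp add: algebra_simps power2_sum flip: power_int_add power_int_mult)
    then show ?thesis using ord[of "m * (a * t)"] sq by simp
  qed
  have shifted: "(\<Sum>x\<in>X. \<omega> powi (\<Sum>p\<in>P. \<epsilon> p * (x p + Mz z p)\<^sup>2)) = G" for z
  proof -
    have "(\<Sum>x\<in>X. \<omega> powi (\<Sum>p\<in>P. \<epsilon> p * (x p + Mz z p)\<^sup>2)) = 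
          (\<Sum>x\<in>X. \<Prod>p\<in>P. \<omega> powi (\<epsilon> p * (x p + Mz z p)\<^sup>2))"
      by (simp add: prod_powi \<open>\<omega> \<noteq> 0\<close>)
    also have "\<dots> = (\<Prod>p\<in>P. \<Sum>t\<in>{0..<m}. \<omega> powi (\<epsilon> p * (t + Mz z p)\<^sup>2))"
      unfolding X_def by (rule prod_sum_PiE[symmetric]) (use assms in auto)
    also have "\<dots> = G" unfolding G_def
      by (intro prod.cong refl sum_periodic_shift[where f = "\<lambda>t. \<omega> powi (_ * t\<^sup>2)"] per \<open>m > 0\<close>)
    finally show ?thesis .
  qed
  have expand: "\<omega> powi (\<Sum>p\<in>P. \<epsilon> p * (x p + Mz z p)\<^sup>2) =
      \<omega> powi (\<Sum>p\<in>P. \<epsilon> p * (x p)\<^sup>2) * (\<Prod>y\<in>B. \<omega> powi (2 * (z y * u x y)))" for x z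
  proof -
    have *: "(\<Sum>y\<in>B. z y * u x y) = (\<Sum>p\<in>P. \<epsilon> p * x p * Mz z p)"
      unfolding u_def Mz_def sum_distrib_left by (subst sum.swap) (simp add: mult_ac)
    have "(\<Sum>p\<in>P. \<epsilon> p * (x p + Mz z p)\<^sup>2) =
      (\<Sum>p\<in>P. \<epsilon> p * (x p)\<^sup>2) + 2 * (\<Sum>p\<in>P. \<epsilon> p * x p * Mz z p) + (\<Sum>p\<in>P. \<epsilon> p * (Mz z p)\<^sup>2)"
      by (simp add: power2_sum algebra_simps sum.distrib sum_distrib_left)
    also have "\<omega> powi \<dots> = \<omega> powi (\<Sum>p\<in>P. \<epsilon> p * (x p)\<^sup>2) * \<omega> powi (2 * (\<Sum>y\<in>B. z y * u x y))"
      using isotropic[of z] \<open>\<omega> \<noteq> 0\<close> by (simp add: * power_int_add Mz_def)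
    finally show ?thesis by (simp add: prod_powi \<open>\<omega> \<noteq> 0\<close> sum_distrib_left)
  qed
  have inner: "(\<Sum>z\<in>Z. \<Prod>y\<in>B. \<omega> powi (2 * (z y * u x y))) = (if x \<in> D then of_int m ^ card B else 0)"
    if "x \<in> X" for x
  proof -
    have "(\<Sum>z\<in>Z. \<Prod>y\<in>B. \<omega> powi (2 * (z y * u x y))) = (\<Prod>y\<in>B. \<Sum>t\<in>{0..<m}. \<omega> powi (2 * (t * u x y)))"
      unfolding Z_def by (rule prod_sum_PiE[symmetric]) (use assms in auto)
    also have "\<dots> = (\<Prod>y\<in>B. if m dvd u x y then of_int m else 0)"
      by (simp only: sum_powi_linear[OF \<open>m > 0\<close> ord])
    also have "\<dots> = (if x \<in> D then of_int m ^ card B else 0)"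
      using that \<open>finite B\<close> by (auto simp: D_def)
    finally show ?thesis .
  qed
  \<comment> \<open>The double sum over coefficient vectors z and all vectors x is evaluated in two
    ways; the common factor m^|B| then cancels.\<close>
  have "of_int m ^ card B * G = (\<Sum>z\<in>Z. \<Sum>x\<in>X. \<omega> powi (\<Sum>p\<in>P. \<epsilon> p * (x p + Mz z p)\<^sup>2))"
    using \<open>m > 0\<close> \<open>finite B\<close> by (simp only: shifted) (simp add: Z_def card_PiE)
  also have "\<dots> = (\<Sum>x\<in>X. \<omega> powi (\<Sum>p\<in>P. \<epsilon> p * (x p)\<^sup>2) * (\<Sum>z\<in>Z. \<Prod>y\<in>B. \<omega> powi (2 * (z y * u x y))))"
    unfolding expand sum_distrib_left by (rule sum.swap)
  also have "\<dots> = (\<Sum>x\<in>X. if x \<in> D then of_int m ^ card B else 0)"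
  proof (intro sum.cong refl)
    fix x assume "x \<in> X"
    then show "\<omega> powi (\<Sum>p\<in>P. \<epsilon> p * (x p)\<^sup>2) * (\<Sum>z\<in>Z. \<Prod>y\<in>B. \<omega> powi (2 * (z y * u x y)))
      = (if x \<in> D then of_int m ^ card B else 0)"
      using self_dual[of x] by (simp only: inner) (auto simp: D_def u_def)
  qed
  also have "\<dots> = of_int m ^ card B * of_nat (card D)"
  proof -
    have "X \<inter> D = D" by (auto simp: D_def)
    then show ?thesis using fin by (simp add: sum.If_cases mult.commute)
  qed
  finally have "G = of_nat (card D)" using \<open>m > 0\<close> by simp
  \<comment> \<open>The zero word lies in the dual code, so the count is positive; it is restricted
    because members of \<open>X\<close> are \<open>undefined\<close> outside
    \<open>P\<close>.\<close>
  moreover have "restrict (\<lambda>_. 0) P \<in> D"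
    using \<open>m > 0\<close> by (auto simp: D_def X_def u_def)
  then have "card D > 0" using fin by (auto simp: card_gt_0_iff D_def)
  ultimately show ?thesis unfolding G_def by blast
qed

text \<open>Replacing s by s + t turns s^2 - t^2 into s^2 + 2st; summing over t first leaves only s
  = 0. For |\<omega>| = 1 the second factor is the complex conjugate of the first.\<close>

lemma gauss_sum_mult_cnj:
  fixes \<omega> :: complex
  assumes "m > 0"
    and ord: "\<And>j. \<omega> powi (2 * j) = 1 \<longleftrightarrow> m dvd j"
    and sq: "\<omega> powi (m\<^sup>2) = 1"
  shows "(\<Sum>t\<in>{0..<m}. \<omega> powi (t\<^sup>2)) * (\<Sum>t\<in>{0..<m}. \<omega> powi (- t\<^sup>2)) = of_int m"
proof -
  have "\<omega> \<noteq> 0" using ord[of m] \<open>m > 0\<close> by auto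
  have per: "\<omega> powi ((s + m)\<^sup>2) = \<omega> powi (s\<^sup>2)" for s
  proof -
    have "\<omega> powi ((s + m)\<^sup>2) = \<omega> powi (s\<^sup>2) * \<omega> powi (2 * (m * s)) * \<omega> powi (m\<^sup>2)"
      using \<open>\<omega> \<noteq> 0\<close> by (simp add: algebra_simps power2_sum flip: power_int_add)
    then show ?thesis using ord[of "m * s"] sq by simp
  qed
  have "(\<Sum>t\<in>{0..<m}. \<omega> powi (t\<^sup>2)) * (\<Sum>t\<in>{0..<m}. \<omega> powi (- t\<^sup>2)) =
     (\<Sum>t\<in>{0..<m}. (\<Sum>s\<in>{0..<m}. \<omega> powi ((s + t)\<^sup>2)) * \<omega> powi (- t\<^sup>2))"
    by (simp only: sum_periodic_shift[where f = "\<lambda>s. \<omega> powi (s\<^sup>2)", OF per \<open>m > 0\<close>] sum_distrib_left)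
  also have "\<dots> = (\<Sum>t\<in>{0..<m}. \<Sum>s\<in>{0..<m}. \<omega> powi (s\<^sup>2) * \<omega> powi (2 * (t * s)))"
    unfolding sum_distrib_right
    using \<open>\<omega> \<noteq> 0\<close> by (intro sum.cong refl) (simp add: power2_sum algebra_simps flip: power_int_add)
  also have "\<dots> = (\<Sum>s\<in>{0..<m}. \<omega> powi (s\<^sup>2) * (\<Sum>t\<in>{0..<m}. \<omega> powi (2 * (t * s))))"
    unfolding sum_distrib_left by (rule sum.swap)
  also have "\<dots> = (\<Sum>s\<in>{0..<m}. if s = 0 then of_int m else 0)"
  proof (intro sum.cong refl)
    fix s assume "s \<in> {0..<m}"
    then have "m dvd s \<longleftrightarrow> s = 0" using zdvd_not_zless[of s m] by force
    then show "\<omega> powi (s\<^sup>2) * (\<Sum>t\<in>{0..<m}. \<omega> powi (2 * (t * s))) = (if s = 0 then of_int m else 0)"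
      unfolding sum_powi_linear[OF \<open>m > 0\<close> ord] by simp
  qed
  also have "\<dots> = of_int m" using \<open>m > 0\<close> by simp
  finally show ?thesis .
qed

section \<open>Quadratic Gauss sums modulo odd powers of a prime congruent to 3 modulo 4\<close>

lemma odd_ord_double:
  fixes \<omega> :: complex
  assumes ord: "\<And>j. \<omega> powi j = 1 \<longleftrightarrow> m dvd j" and "odd m"
  shows "\<omega> powi (2 * j) = 1 \<longleftrightarrow> m dvd j"
  unfolding ord using \<open>odd m\<close> by (simp add: coprime_dvd_mult_right_iff)

text \<open>Write t = a + p^(e+1) b with 0 <= b < p. Modulo p^(e+2) its square is a^2 + 2 p^(e+1) a
  b, so the sum over b vanishes unless p divides a; the surviving a are the multiples of p. The
  exponent drops by 2, which preserves its parity.\<close>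

lemma gauss_sum_prime_power_reduce:
  fixes \<omega> :: complex and p :: nat
  assumes "prime p" "odd p" and ord: "\<And>j. \<omega> powi j = 1 \<longleftrightarrow> int p ^ (e + 2) dvd j"
  shows "(\<Sum>t\<in>{0..<int p ^ (e + 2)}. \<omega> powi (t\<^sup>2)) =
         of_nat p * (\<Sum>t\<in>{0..<int p ^ e}. (\<omega> powi ((int p)\<^sup>2)) powi (t\<^sup>2))"
proof -
  define P where "P = int p"
  have P: "P > 0" using prime_gt_0_nat[OF \<open>prime p\<close>] by (simp add: P_def)
  have ord: "\<omega> powi j = 1 \<longleftrightarrow> P ^ (e + 2) dvd j" for j using ord by (simp add: P_def)
  have "\<omega> \<noteq> 0" using ord[of "P ^ (e + 2)"] P by auto
  \<comment> \<open>A primitive p-th root of unity, through which the sum over b becomes an instance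
    of orthogonality.\<close>
  define \<eta> where "\<eta> = \<omega> powi (P ^ (e + 1))"
  have eta: "\<eta> powi j = 1 \<longleftrightarrow> P dvd j" for j
    using P by (simp add: \<eta>_def ord flip: power_int_mult)
  have eta2: "\<eta> powi (2 * j) = 1 \<longleftrightarrow> P dvd j" for j
    by (rule odd_ord_double[OF eta]) (use \<open>odd p\<close> in \<open>simp add: P_def\<close>)
  have div_less: "t div A < B" if "A > 0" "t < B * A" for t A B :: int
  proof -
    have "t div A * A < B * A"
      using that div_mult_mod_eq[of t A] pos_mod_sign[of A t] by linarith
    then show ?thesis using that by simp
  qed
  have "(\<Sum>t\<in>{0..<P ^ (e + 2)}. \<omega> powi (t\<^sup>2)) =
      (\<Sum>(a, b)\<in>{0..<P ^ (e + 1)} \<times> {0..<P}. \<omega> powi ((a + P ^ (e + 1) * b)\<^sup>2))"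
  proof (rule sum.reindex_bij_witness[where
        i = "\<lambda>(a, b). a + P ^ (e + 1) * b" and j = "\<lambda>t. (t mod P ^ (e + 1), t div P ^ (e + 1))"])
    fix x assume x: "x \<in> {0..<P ^ (e + 1)} \<times> {0..<P}"
    then obtain a b where ab: "x = (a, b)" "0 \<le> a" "a < P ^ (e + 1)" "0 \<le> b" "b < P" by auto
    have "P ^ (e + 1) * b \<le> P ^ (e + 1) * (P - 1)"
      using ab P by (intro mult_left_mono) auto
    then show "(case x of (a, b) \<Rightarrow> a + P ^ (e + 1) * b) \<in> {0..<P ^ (e + 2)}"
      using ab P by (auto simp: algebra_simps)
    show "((case x of (a, b) \<Rightarrow> a + P ^ (e + 1) * b) mod P ^ (e + 1),
           (case x of (a, b) \<Rightarrow> a + P ^ (e + 1) * b) div P ^ (e + 1)) = x"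
      using ab by (simp del: power_Suc add: div_pos_pos_trivial)
  next
    fix t assume t: "t \<in> {0..<P ^ (e + 2)}"
    then have "t div P ^ (e + 1) < P" using div_less[of "P ^ (e + 1)" t P] P by simp
    then show "(t mod P ^ (e + 1), t div P ^ (e + 1)) \<in> {0..<P ^ (e + 1)} \<times> {0..<P}"
      using P t by (auto simp del: power_Suc simp: pos_imp_zdiv_nonneg_iff)
  qed auto
  also have "\<dots> = (\<Sum>a\<in>{0..<P ^ (e + 1)}. \<omega> powi (a\<^sup>2) * (\<Sum>b\<in>{0..<P}. \<eta> powi (2 * (b * a))))"
    unfolding sum.cartesian_product[symmetric] sum_distrib_left
  proof (intro sum.cong refl)
    fix a b
    have "\<omega> powi ((a + P ^ (e + 1) * b)\<^sup>2) = \<omega> powi (a\<^sup>2) * \<omega> powi (P ^ (e + 1) * (2 * (b * a))) * \<omega> powi (P ^ (e + 2) * (P ^ e * b\<^sup>2))"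
      using \<open>\<omega> \<noteq> 0\<close> by (simp add: algebra_simps power2_sum power2_eq_square flip: power_int_add)
    then show "\<omega> powi ((a + P ^ (e + 1) * b)\<^sup>2) = \<omega> powi (a\<^sup>2) * \<eta> powi (2 * (b * a))"
      using ord[of "P ^ (e + 2) * (P ^ e * b\<^sup>2)"] by (simp add: \<eta>_def power_int_mult)
  qed
  also have "\<dots> = (\<Sum>a\<in>{0..<P ^ (e + 1)}. if P dvd a then of_int P * \<omega> powi (a\<^sup>2) else 0)"
    by (intro sum.cong refl) (simp add: sum_powi_linear[OF P eta2])
  also have "\<dots> = (\<Sum>a\<in>{a\<in>{0..<P ^ (e + 1)}. P dvd a}. of_int P * \<omega> powi (a\<^sup>2))"
    by (rule sum.inter_filter[symmetric]) simp
  also have "\<dots> = (\<Sum>t\<in>{0..<P ^ e}. of_int P * (\<omega> powi (P\<^sup>2)) powi (t\<^sup>2))"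
    using P by (intro sum.reindex_bij_witness[where i = "\<lambda>t. P * t" and j = "\<lambda>a. a div P"])
      (auto simp: pos_imp_zdiv_nonneg_iff power_mult_distrib simp flip: power_int_mult elim!: dvdE)
  finally show ?thesis by (simp add: P_def sum_distrib_left)
qed

text \<open>Here -1 is not a square modulo p: since (p - 1)/2 is odd, raising s^2 = -t^2 to that
  power contradicts Fermat's little theorem when p does not divide t.\<close>

lemma prime_3_mod_4_dvd_sum_squares:
  fixes s t :: int and p :: nat
  assumes "prime p" "p mod 4 = 3" "int p dvd s\<^sup>2 + t\<^sup>2"
  shows "int p dvd t"
proof (rule ccontr)
  assume t: "\<not> int p dvd t"
  have s: "\<not> int p dvd s"
  proof
    assume "int p dvd s"
    then have "int p dvd s\<^sup>2" by (simp add: power2_eq_square)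
    with assms(3) have "int p dvd t\<^sup>2" by (simp add: dvd_add_right_iff)
    then show False using t \<open>prime p\<close> by (simp add: prime_dvd_power_iff)
  qed
  have fermat: "[x ^ (p - 1) = 1] (mod int p)" if "\<not> int p dvd x" for x
  proof -
    have c: "coprime x (int p)" using that \<open>prime p\<close>
      using prime_imp_coprime[of "int p" x] by (simp add: coprime_commute)
    interpret residues "int p" "residue_ring (int p)" by (rule residues.intro) (use prime_gt_1_nat[OF \<open>prime p\<close>] in simp_all)
    show ?thesis using euler_theorem[OF c] \<open>prime p\<close> by (simp add: totient_prime)
  qed
  define h where "h = (p - 1) div 2"
  have "odd h" "p - 1 = 2 * h" using assms(2) unfolding h_def by presburger+
  have "[s\<^sup>2 = - t\<^sup>2] (mod int p)" using assms(3) by (simp add: cong_iff_dvd_diff)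
  then have "[(s\<^sup>2) ^ h = (- t\<^sup>2) ^ h] (mod int p)" by (rule cong_pow)
  then have "[s ^ (p - 1) = - (t ^ (p - 1))] (mod int p)"
    using \<open>odd h\<close> unfolding \<open>p - 1 = 2 * h\<close> power_mult by simp
  with fermat[OF s] fermat[OF t] have "[1 = - 1] (mod int p)"
    by (meson cong_minus_minus_iff cong_sym cong_trans)
  then have "int p dvd 2" by (simp add: cong_iff_dvd_diff)
  then have "p \<le> 2" using zdvd_imp_le[of "int p" 2] by simp
  then show False using assms(2) by presburger
qed

text \<open>As -1 is a non-residue, the squares of 1, ..., (p-1)/2 together with their negatives run
  once through the nonzero residues. So each half of the nonzero t contributes the sum of all
  nontrivial p-th roots of unity, namely -1, and t = 0 contributes 2. For |\<omega>| = 1 this says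
  that the Gauss sum is purely imaginary.\<close>

lemma gauss_sum_prime_imaginary:
  fixes \<omega> :: complex and p :: nat
  assumes "prime p" "p mod 4 = 3" and ord: "\<And>j. \<omega> powi j = 1 \<longleftrightarrow> int p dvd j"
  shows "(\<Sum>t\<in>{0..<int p}. \<omega> powi (t\<^sup>2) + \<omega> powi (- t\<^sup>2)) = 0"
proof -
  define P where "P = int p"
  define h where "h = (P - 1) div 2"
  have P: "P > 0" "odd P" "P = 2 * h + 1" "h > 0"
    using assms(2) unfolding P_def h_def by presburger+
  have pr: "prime P" using \<open>prime p\<close> by (simp add: P_def)
  have ord: "\<omega> powi j = 1 \<longleftrightarrow> P dvd j" for j using ord by (simp add: P_def)
  have ord2: "\<omega> powi (2 * j) = 1 \<longleftrightarrow> P dvd j" for j by (rule odd_ord_double[OF ord \<open>odd P\<close>])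
  have "\<omega> \<noteq> 0" using ord[of P] P(1) by auto
  have pm: "\<omega> powi (j mod P) = \<omega> powi j" for j
  proof -
    have "\<omega> powi j = \<omega> powi (j mod P) * \<omega> powi (P * (j div P))"
      using \<open>\<omega> \<noteq> 0\<close> by (simp flip: power_int_add)
    then show ?thesis using ord[of "P * (j div P)"] by simp
  qed
  define T where "T = {1..h}"
  define Q where "Q = (\<lambda>t. t\<^sup>2 mod P) ` T"
  define R where "R = (\<lambda>t. (- t\<^sup>2) mod P) ` T"
  have ndvd: "\<not> P dvd t" if "t \<in> T" for t
    using that P zdvd_not_zless[of t P] by (auto simp: T_def)
  have inj: "s = t" if "s \<in> T" "t \<in> T" "P dvd s\<^sup>2 - t\<^sup>2" for s t
  proof -
    have "P dvd (s - t) * (s + t)" using that(3) by (simp add: power2_eq_square algebra_simps)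
    then have "P dvd s - t \<or> P dvd s + t" using pr by (simp add: prime_dvd_mult_iff)
    moreover have "\<not> P dvd s + t" using that P zdvd_not_zless[of "s + t" P] by (auto simp: T_def)
    ultimately have "P dvd s - t" by blast
    moreover have "\<bar>s - t\<bar> < P" using that P by (auto simp: T_def)
    ultimately show "s = t" using dvd_imp_le_int[of "s - t" P] by force
  qed
  have "inj_on (\<lambda>t. t\<^sup>2 mod P) T" "inj_on (\<lambda>t. (- t\<^sup>2) mod P) T"
    using inj by (auto intro!: inj_onI simp: mod_eq_dvd_iff dvd_diff_commute)
  note injs = this
  have disj: "Q \<inter> R = {}"
  proof (rule ccontr)
    assume "Q \<inter> R \<noteq> {}"
    then obtain s t where st: "s \<in> T" "t \<in> T" "s\<^sup>2 mod P = (- t\<^sup>2) mod P" by (auto simp: Q_def R_def)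
    then have "int p dvd s\<^sup>2 + t\<^sup>2" by (simp add: mod_eq_dvd_iff P_def)
    then have "P dvd t" unfolding P_def by (rule prime_3_mod_4_dvd_sum_squares[OF assms(1,2)])
    then show False using ndvd[OF st(2)] by simp
  qed
  have sub: "Q \<union> R \<subseteq> {1..<P}"
  proof -
    have "x mod P \<in> {1..<P}" if "\<not> P dvd x" for x
    proof -
      have "x mod P \<noteq> 0" "0 \<le> x mod P" "x mod P < P"
        using that \<open>P > 0\<close> pos_mod_bound[of P x] by (auto simp: dvd_eq_mod_eq_0)
      then show ?thesis by simp
    qed
    moreover have "\<not> P dvd t\<^sup>2" if "t \<in> T" for t
      using ndvd[OF that] pr by (simp add: prime_dvd_power_iff)
    ultimately show ?thesis by (auto simp: Q_def R_def)
  qed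
  \<comment> \<open>Two disjoint sets of size h inside the 2h nonzero residues must exhaust
    them.\<close>
  have "card (Q \<union> R) = card {1..<P}"
    using card_Un_disjoint[OF _ _ disj] card_image[OF injs(1)] card_image[OF injs(2)] P
    by (simp add: Q_def R_def T_def)
  then have QR: "Q \<union> R = {1..<P}" using sub by (intro card_subset_eq) auto
  have "(\<Sum>t\<in>T. \<omega> powi (t\<^sup>2) + \<omega> powi (- t\<^sup>2)) = (\<Sum>a\<in>Q. \<omega> powi a) + (\<Sum>a\<in>R. \<omega> powi a)"
    unfolding Q_def R_def sum.reindex[OF injs(1)] sum.reindex[OF injs(2)] by (simp add: pm sum.distrib)
  also have "\<dots> = (\<Sum>a\<in>{1..<P}. \<omega> powi a)"
    unfolding QR[symmetric] by (rule sum.union_disjoint[symmetric]) (use disj in \<open>auto simp: Q_def R_def T_def\<close>)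
  also have "\<dots> = -1"
  proof -
    have "(\<Sum>a\<in>{0..<P}. \<omega> powi a) = (\<Sum>a\<in>{0..<P}. \<omega> powi (a + 1))"
    proof (rule sum_periodic_shift[symmetric])
      show "\<omega> powi (t + P) = \<omega> powi t" for t
        using ord[of P] \<open>\<omega> \<noteq> 0\<close> by (simp add: power_int_add)
    qed (rule P)
    also have "\<dots> = (\<Sum>a\<in>{0..<P}. \<omega> powi a) * \<omega>"
      using \<open>\<omega> \<noteq> 0\<close> by (simp add: sum_distrib_right power_int_add)
    finally have "(\<Sum>a\<in>{0..<P}. \<omega> powi a) = 0"
      using ord[of 1] P by auto
    moreover have "{0..<P} = insert 0 {1..<P}" using P by auto
    ultimately show ?thesis by (simp add: add_eq_0_iff)
  qed
  finally have half: "(\<Sum>t\<in>T. \<omega> powi (t\<^sup>2) + \<omega> powi (- t\<^sup>2)) = -1" .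
  \<comment> \<open>The reflection t to P - t fixes squares modulo P and exchanges the two
    halves.\<close>
  have other: "(\<Sum>t\<in>{h<..<P}. \<omega> powi (t\<^sup>2) + \<omega> powi (- t\<^sup>2)) = -1"
  proof -
    have "(\<Sum>t\<in>{h<..<P}. \<omega> powi (t\<^sup>2) + \<omega> powi (- t\<^sup>2)) = (\<Sum>t\<in>T. \<omega> powi ((P - t)\<^sup>2) + \<omega> powi (- (P - t)\<^sup>2))"
      by (rule sum.reindex_bij_witness[where i = "\<lambda>t. P - t" and j = "\<lambda>t. P - t"]) (use P in \<open>auto simp: T_def\<close>)
    also have "\<dots> = (\<Sum>t\<in>T. \<omega> powi (t\<^sup>2) + \<omega> powi (- t\<^sup>2))"
    proof (intro sum.cong refl)
      fix t
      have "(P - t)\<^sup>2 mod P = t\<^sup>2 mod P" "(- (P - t)\<^sup>2) mod P = (- t\<^sup>2) mod P"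
        by (simp_all add: mod_eq_dvd_iff power2_eq_square algebra_simps)
      then show "\<omega> powi ((P - t)\<^sup>2) + \<omega> powi (- (P - t)\<^sup>2) = \<omega> powi (t\<^sup>2) + \<omega> powi (- t\<^sup>2)"
        using pm[of "(P - t)\<^sup>2"] pm[of "t\<^sup>2"] pm[of "- (P - t)\<^sup>2"] pm[of "- t\<^sup>2"] by simp
    qed
    finally show ?thesis using half by simp
  qed
  have "(\<Sum>t\<in>{0..<P}. \<omega> powi (t\<^sup>2) + \<omega> powi (- t\<^sup>2)) = 
      (\<Sum>t\<in>insert 0 (T \<union> {h<..<P}). \<omega> powi (t\<^sup>2) + \<omega> powi (- t\<^sup>2))"
    by (rule sum.cong) (use P in \<open>auto simp: T_def\<close>)
  also have "\<dots> = 2 + (\<Sum>t\<in>T \<union> {h<..<P}. \<omega> powi (t\<^sup>2) + \<omega> powi (- t\<^sup>2))"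
    by (subst sum.insert) (use P in \<open>auto simp: T_def\<close>)
  also have "\<dots> = 2 + ((\<Sum>t\<in>T. \<omega> powi (t\<^sup>2) + \<omega> powi (- t\<^sup>2)) + (\<Sum>t\<in>{h<..<P}. \<omega> powi (t\<^sup>2) + \<omega> powi (- t\<^sup>2)))"
    by (subst sum.union_disjoint) (auto simp: T_def)
  finally show ?thesis unfolding half other by (simp add: P_def)
qed

text \<open>Induction on f: the reduction step replaces \<omega> by \<omega>^(p^2) and takes out a
  factor p. It is applied to \<omega> and to its inverse, the latter accounting for the negated
  squares.\<close>

lemma gauss_sum_odd_prime_power_imaginary:
  fixes \<omega> :: complex and p :: nat
  assumes "prime p" "p mod 4 = 3" and "\<And>j. \<omega> powi j = 1 \<longleftrightarrow> int p ^ (2 * f + 1) dvd j"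
  shows "(\<Sum>t\<in>{0..<int p ^ (2 * f + 1)}. \<omega> powi (t\<^sup>2)) + (\<Sum>t\<in>{0..<int p ^ (2 * f + 1)}. \<omega> powi (- t\<^sup>2)) = 0"
  using assms(3)
proof (induction f arbitrary: \<omega>)
  case 0
  then show ?case
    using gauss_sum_prime_imaginary[OF assms(1,2), of \<omega>] by (simp add: sum.distrib)
next
  case (Suc f)
  have "odd p" using assms(2) by presburger
  have p0: "p > 0" using assms(1) by (simp add: prime_gt_0_nat)
  have e: "2 * Suc f + 1 = (2 * f + 1) + 2" by simp
  note prems = Suc.prems[unfolded e]
  have inv: "inverse \<omega> powi j = 1 \<longleftrightarrow> int p ^ (2 * f + 1 + 2) dvd j" for j
    using prems[of j] by (simp add: power_int_inverse)
  have IH: "(\<omega> powi ((int p)\<^sup>2)) powi j = 1 \<longleftrightarrow> int p ^ (2 * f + 1) dvd j" for j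
  proof -
    have "int p ^ (2 * f + 1 + 2) = (int p)\<^sup>2 * int p ^ (2 * f + 1)"
      by (simp only: power_add mult.commute)
    then show ?thesis
      using p0 unfolding power_int_mult[symmetric] prems by (simp only: dvd_times_left_cancel_iff) simp
  qed
  have neg: "\<omega> powi (- j) = inverse \<omega> powi j" "(\<omega> powi n) powi (- j) = (inverse \<omega> powi n) powi j" for j n
    by (simp_all add: power_int_minus power_int_inverse)
  show ?case
    unfolding e neg gauss_sum_prime_power_reduce[OF assms(1) \<open>odd p\<close> prems]
      gauss_sum_prime_power_reduce[OF assms(1) \<open>odd p\<close> inv]
    using Suc.IH[OF IH] unfolding neg by (simp flip: distrib_left)
qed

section \<open>Parameters of the graph\<close>

definition mtrace :: "'a::comm_ring_1 mat \<Rightarrow> 'a" where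
  "mtrace A = (\<Sum>i<dim_row A. A $$ (i, i))"

lemma mtrace_mult_commute:
  assumes "A \<in> carrier_mat n n" "B \<in> carrier_mat n n"
  shows "mtrace (A * B) = mtrace (B * A)"
proof -
  have "mtrace (A * B) = (\<Sum>i<n. \<Sum>j<n. A $$ (i, j) * B $$ (j, i))"
    using assms by (simp add: mtrace_def scalar_prod_def atLeast0LessThan)
  also have "\<dots> = (\<Sum>i<n. \<Sum>j<n. B $$ (i, j) * A $$ (j, i))"
    by (subst sum.swap) (simp add: mult.commute)
  also have "\<dots> = mtrace (B * A)"
    using assms by (simp add: mtrace_def scalar_prod_def atLeast0LessThan)
  finally show ?thesis .
qed

lemma mtrace_similar:
  assumes "A \<in> carrier_mat n n" "P \<in> carrier_mat n n" "Q \<in> carrier_mat n n" "Q * P = 1\<^sub>m n"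
  shows "mtrace (P * A * Q) = mtrace A"
proof -
  have "mtrace (P * A * Q) = mtrace (Q * (P * A))"
    using assms by (intro mtrace_mult_commute) auto
  also have "Q * (P * A) = A"
    using assms by (subst assoc_mult_mat[symmetric, of _ n n _ n _ n]) auto
  finally show ?thesis .
qed

text \<open>By Schur decomposition \<open>A\<close> is similar to an upper triangular matrix with
  diagonal \<open>es\<close>; the diagonal of its square consists of the squares of these entries,
  and similarity preserves traces.\<close>

lemma mtrace_complex_eigenvalues:
  fixes A :: "complex mat"
  assumes A: "A \<in> carrier_mat n n" and cp: "char_poly A = (\<Prod>e\<leftarrow>es. [:- e, 1:])"
  shows "mtrace A = sum_list es" "mtrace (A * A) = sum_list (map (\<lambda>e. e * e) es)"
proof -
  obtain B P Q where "schur_decomposition A es = (B, P, Q)" by (cases "schur_decomposition A es")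
  from schur_decomposition[OF A cp this]
  have w: "similar_mat_wit A B P Q" and ut: "upper_triangular B" and diag: "diag_mat B = es" by auto
  from w A have car: "B \<in> carrier_mat n n" "P \<in> carrier_mat n n" "Q \<in> carrier_mat n n"
    and PQ: "Q * P = 1\<^sub>m n" and AB: "A = P * B * Q"
    unfolding similar_mat_wit_def Let_def by auto
  have es: "length es = n" "\<And>i. i < n \<Longrightarrow> es ! i = B $$ (i, i)"
    using car(1) by (auto simp: diag_mat_def simp flip: diag)
  have sums: "sum_list (map f es) = (\<Sum>i<n. f (B $$ (i, i)))" for f :: "complex \<Rightarrow> complex"
    using es by (simp add: sum_list_sum_nth atLeast0LessThan)
  show "mtrace A = sum_list es"
    unfolding AB mtrace_similar[OF car PQ] using sums[of "\<lambda>x. x"] car by (simp add: mtrace_def)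
  have "A * A = P * (B * B) * Q"
  proof -
    have "A * A = P * B * (Q * P) * B * Q"
      unfolding AB using car by (simp add: assoc_mult_mat[of _ n n _ n _ n])
    then show ?thesis using car PQ by (simp add: assoc_mult_mat[of _ n n _ n _ n])
  qed
  then have "mtrace (A * A) = mtrace (B * B)"
    using mtrace_similar[of "B * B" n P Q] car PQ by simp
  also have "\<dots> = (\<Sum>i<n. B $$ (i, i) * B $$ (i, i))"
  proof -
    have "(\<Sum>j<n. B $$ (i, j) * B $$ (j, i)) = B $$ (i, i) * B $$ (i, i)" if "i < n" for i
    proof -
      have "(\<Sum>j<n. B $$ (i, j) * B $$ (j, i)) = (\<Sum>j\<in>{i}. B $$ (i, j) * B $$ (j, i))"
      proof (rule sum.mono_neutral_right)
        show "\<forall>j\<in>{..<n} - {i}. B $$ (i, j) * B $$ (j, i) = 0"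
          using ut car that by (metis DiffD1 DiffD2 carrier_matD(1) insertI1 lessThan_iff linorder_neqE_nat mult_eq_0_iff upper_triangularD)
      qed (use that in auto)
      then show ?thesis by simp
    qed
    then show ?thesis using car by (simp add: mtrace_def scalar_prod_def atLeast0LessThan)
  qed
  finally show "mtrace (A * A) = sum_list (map (\<lambda>e. e * e) es)" by (simp add: sums)
qed

lemma order_prod_linear:
  fixes es :: "'a::idom list"
  shows "Polynomial.order x (\<Prod>e\<leftarrow>es. [:- e, 1:]) = count_list es x"
proof (induction es)
  case (Cons e es)
  have "(\<Prod>e\<leftarrow>es. [:- e, 1:]) \<noteq> 0" by (auto simp: prod_list_zero_iff)
  then show ?case using Cons by (simp add: order_mult order_linear' del: mult_pCons_left)
qed simp

lemma sum_list_three_values: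
  fixes f :: "'a \<Rightarrow> 'b::comm_ring_1"
  assumes "set xs \<subseteq> {x, y, z}" "x \<noteq> y" "x \<noteq> z" "y \<noteq> z"
  shows "sum_list (map f xs) = of_nat (count_list xs x) * f x + of_nat (count_list xs y) * f y + of_nat (count_list xs z) * f z"
  using assms by (induction xs) (auto simp: algebra_simps)

text \<open>Eigenvectors for \<theta> \<noteq> k are orthogonal to the all-ones vector, which is an
  eigenvector for k of the symmetric matrix.\<close>

lemma symmetric_srg_eigenvector_sum:
  fixes A :: "nat \<Rightarrow> nat \<Rightarrow> 'a::field" and f :: "nat \<Rightarrow> 'a"
  assumes sym: "\<And>x y. A x y = A y x"
    and deg: "\<And>x. x < v \<Longrightarrow> (\<Sum>y<v. A x y) = k"
    and ev: "\<And>x. x < v \<Longrightarrow> (\<Sum>y<v. A x y * f y) = \<theta> * f x"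
    and "\<theta> \<noteq> k"
  shows "(\<Sum>y<v. f y) = 0"
proof -
  have "\<theta> * (\<Sum>x<v. f x) = (\<Sum>x<v. \<Sum>y<v. A x y * f y)" by (simp add: ev sum_distrib_left)
  also have "\<dots> = (\<Sum>y<v. (\<Sum>x<v. A y x) * f y)"
    by (subst sum.swap) (simp add: sum_distrib_right sym)
  also have "\<dots> = k * (\<Sum>x<v. f x)" by (simp add: deg sum_distrib_left)
  finally show ?thesis using \<open>\<theta> \<noteq> k\<close> by simp
qed

text \<open>The hypothesis \<open>sq\<close> reads A^2 = l A + mu J + (k - mu) I with J the all-ones
  matrix. Applied to an eigenvector, the J term vanishes by the previous lemma.\<close>

lemma srg_eigenvalue_quadratic:
  fixes A :: "nat \<Rightarrow> nat \<Rightarrow> 'a::field" and f :: "nat \<Rightarrow> 'a"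
  assumes sym: "\<And>x y. A x y = A y x"
    and deg: "\<And>x. x < v \<Longrightarrow> (\<Sum>y<v. A x y) = k"
    and sq: "\<And>x y. x < v \<Longrightarrow> y < v \<Longrightarrow> (\<Sum>z<v. A x z * A z y) = l * A x y + mu + (if x = y then k - mu else 0)"
    and ev: "\<And>x. x < v \<Longrightarrow> (\<Sum>y<v. A x y * f y) = \<theta> * f x"
    and "x < v" "f x \<noteq> 0" "\<theta> \<noteq> k"
  shows "\<theta>\<^sup>2 = l * \<theta> + (k - mu)"
proof -
  have "\<theta>\<^sup>2 * f x = (\<Sum>z<v. A x z * (\<Sum>y<v. A z y * f y))"
    using \<open>x < v\<close> by (simp add: ev power2_eq_square mult.left_commute mult.assoc flip: sum_distrib_left)
  also have "\<dots> = (\<Sum>y<v. (\<Sum>z<v. A x z * A z y) * f y)"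
    unfolding sum_distrib_left sum_distrib_right by (subst sum.swap) (simp add: mult.assoc)
  also have "\<dots> = (\<Sum>y<v. l * (A x y * f y) + mu * f y + (if x = y then (k - mu) * f y else 0))"
    using \<open>x < v\<close> by (intro sum.cong refl) (auto simp: sq distrib_right mult.assoc)
  also have "\<dots> = l * (\<theta> * f x) + mu * (\<Sum>y<v. f y) + (k - mu) * f x"
    using \<open>x < v\<close> by (simp add: sum.distrib ev flip: sum_distrib_left)
  also have "(\<Sum>y<v. f y) = 0" by (rule symmetric_srg_eigenvector_sum[OF sym deg ev \<open>\<theta> \<noteq> k\<close>])
  finally have "(\<theta>\<^sup>2 - (l * \<theta> + (k - mu))) * f x = 0" by (simp add: algebra_simps)
  then show ?thesis using \<open>f x \<noteq> 0\<close> by simp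
qed

section \<open>The adjacency matrix of a strongly regular graph and its spectrum\<close>

context
  fixes v k lam mu :: nat and E :: "nat \<Rightarrow> nat \<Rightarrow> bool"
  assumes srg: "strongly_regular v E k lam mu"
begin

lemma srg_adj_sym: "of_bool (E x y) = (of_bool (E y x) :: 'a::zero_neq_one)"
  using srg by (auto simp: strongly_regular_def simple_graph_def)

lemma srg_degree:
  assumes "x < v"
  shows "card ({..<v} \<inter> {y. E x y}) = k"
proof -
  have "{..<v} \<inter> {y. E x y} = nbrs v E x" by (auto simp: nbrs_def)
  then show ?thesis using srg assms by (simp add: strongly_regular_def)
qed

lemma srg_adj_row_sum:
  assumes "x < v"
  shows "(\<Sum>y<v. of_bool (E x y)) = (of_nat k :: 'a::field)"
  using srg_degree[OF assms] by simp

lemma srg_adj_square: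
  assumes "x < v" "y < v"
  shows "(\<Sum>z<v. of_bool (E x z) * of_bool (E z y)) =
    (of_nat lam - of_nat mu) * of_bool (E x y) + of_nat mu + (if x = y then of_nat k - of_nat mu else (0::'a::field))"
proof -
  have sg: "\<And>x y. E x y \<longleftrightarrow> E y x" "\<And>x. \<not> E x x"
    using srg by (auto simp: strongly_regular_def simple_graph_def)
  have "{..<v} \<inter> {z. E x z \<and> E z y} = nbrs v E x \<inter> nbrs v E y" using sg by (auto simp: nbrs_def)
  moreover have "of_bool (E x z) * of_bool (E z y) = (if E x z \<and> E z y then 1 else (0::'a))" for z by simp
  ultimately have "(\<Sum>z<v. of_bool (E x z) * of_bool (E z y)) = (of_nat (card (nbrs v E x \<inter> nbrs v E y)) :: 'a)"
    by (simp add: sum.If_cases)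
  moreover have "card (nbrs v E x \<inter> nbrs v E y) = (if x = y then k else if E x y then lam else mu)"
    using srg assms unfolding strongly_regular_def by auto
  ultimately show ?thesis using sg by auto
qed

text \<open>Counts walks of length two from vertex 0, once by degrees and once through the entries
  of A^2.\<close>

lemma srg_parameter_identity:
  assumes "v > 0"
  shows "(of_nat k)\<^sup>2 = (of_nat lam - of_nat mu) * of_nat k + of_nat v * of_nat mu + (of_nat k - (of_nat mu :: 'a::field))"
proof -
  have "(of_nat k)\<^sup>2 = (\<Sum>z<v. of_bool (E 0 z) * (\<Sum>y<v. of_bool (E z y)) :: 'a)"
  proof -
    have "(\<Sum>z<v. of_bool (E 0 z) * (\<Sum>y<v. of_bool (E z y)) :: 'a) = (\<Sum>z<v. of_bool (E 0 z) * of_nat k)"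
      by (intro sum.cong refl) (simp only: srg_adj_row_sum lessThan_iff)
    also have "\<dots> = of_nat k * of_nat k"
      by (simp only: sum_distrib_right[symmetric] srg_adj_row_sum[OF assms])
    finally show ?thesis by (simp add: power2_eq_square)
  qed
  also have "\<dots> = (\<Sum>y<v. \<Sum>z<v. of_bool (E 0 z) * of_bool (E z y))"
    unfolding sum_distrib_left by (rule sum.swap)
  also have "\<dots> = (\<Sum>y<v. (of_nat lam - of_nat mu) * of_bool (E 0 y) + of_nat mu + (if 0 = y then of_nat k - of_nat mu else 0))"
    using assms by (intro sum.cong refl srg_adj_square) auto
  also have "\<dots> = (of_nat lam - of_nat mu) * of_nat k + of_nat v * of_nat mu + (of_nat k - of_nat mu)"
    using assms by (simp add: sum.distrib srg_degree flip: sum_distrib_left)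
  finally show ?thesis .
qed

lemma srg_adj_eigenvalue:
  fixes \<theta> :: "'a::field"
  assumes ev: "eigenvalue (mat v v (\<lambda>(i, j). of_bool (E i j))) \<theta>" and "\<theta> \<noteq> of_nat k"
  shows "\<theta>\<^sup>2 = (of_nat lam - of_nat mu) * \<theta> + (of_nat k - of_nat mu)"
proof -
  let ?A = "mat v v (\<lambda>(i, j). of_bool (E i j)) :: 'a mat"
  obtain w where w: "w \<in> carrier_vec v" "w \<noteq> 0\<^sub>v v" "?A *\<^sub>v w = \<theta> \<cdot>\<^sub>v w"
    using ev by (auto simp: eigenvalue_def eigenvector_def)
  have ev: "(\<Sum>y<v. of_bool (E x y) * w $ y) = \<theta> * w $ x" if "x < v" for x
  proof -
    have "(?A *\<^sub>v w) $ x = (\<theta> \<cdot>\<^sub>v w) $ x" by (simp add: w)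
    then show ?thesis using that w(1) by (simp add: scalar_prod_def atLeast0LessThan)
  qed
  obtain x where x: "x < v" "w $ x \<noteq> 0"
    using w(1,2) by (metis carrier_vecD eq_vecI index_zero_vec)
  show ?thesis
    by (rule srg_eigenvalue_quadratic[where A = "\<lambda>x y. of_bool (E x y)" and f = "\<lambda>x. w $ x",
        OF srg_adj_sym srg_adj_row_sum srg_adj_square ev x \<open>\<theta> \<noteq> of_nat k\<close>])
qed

text \<open>Take the trace of (A - k I)(A - \<theta> I). All eigenvalues lie in {k, \<theta>,
  \<tau>} and only \<tau> contributes, while tr A = 0 and tr A^2 = v k give the right-hand side. The
  argument runs over the complex numbers, where the characteristic polynomial splits; root orders
  are unaffected by the embedding of the reals.\<close>

lemma srg_multiplicity_trace:
  fixes \<theta> \<tau> :: real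
  assumes lin: "real lam - real mu = \<theta> + \<tau>" and const: "real k - real mu = - \<theta> * \<tau>"
    and dist: "real k \<noteq> \<theta>" "real k \<noteq> \<tau>" "\<theta> \<noteq> \<tau>"
  shows "real (eig_mult (adj_matrix v E) \<tau>) * ((\<tau> - real k) * (\<tau> - \<theta>)) = real v * real k * (1 + \<theta>)"
proof -
  define A :: "complex mat" where "A = mat v v (\<lambda>(i, j). of_bool (E i j))"
  have A: "A \<in> carrier_mat v v" by (simp add: A_def)
  have hom: "map_mat complex_of_real (adj_matrix v E) = A"
    by (rule eq_matI) (auto simp: adj_matrix_def A_def)
  have car: "adj_matrix v E \<in> carrier_mat v v" by (simp add: adj_matrix_def)
  obtain es where cp: "char_poly A = (\<Prod>e\<leftarrow>es. [:- e, 1:])" and len: "length es = v"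
    using char_poly_factorized[OF A] by blast
  have set: "set es \<subseteq> {of_nat k, complex_of_real \<theta>, complex_of_real \<tau>}"
  proof
    fix e assume "e \<in> set es"
    then have "poly (char_poly A) e = 0" unfolding cp by (auto simp: poly_prod_list prod_list_zero_iff)
    then have ev: "eigenvalue A e" using eigenvalue_root_char_poly[OF A] by simp
    show "e \<in> {of_nat k, complex_of_real \<theta>, complex_of_real \<tau>}"
    proof (cases "e = of_nat k")
      case False
      have l: "of_nat lam - of_nat mu = complex_of_real (\<theta> + \<tau>)" 
        unfolding lin[symmetric] by simp
      have c: "of_nat k - of_nat mu = complex_of_real (- \<theta> * \<tau>)" 
        unfolding const[symmetric] by simp
      have "e\<^sup>2 = complex_of_real (\<theta> + \<tau>) * e + complex_of_real (- \<theta> * \<tau>)"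
        using srg_adj_eigenvalue[OF ev[unfolded A_def] False] unfolding l c .
      then have "(e - complex_of_real \<theta>) * (e - complex_of_real \<tau>) = 0"
        by (simp add: power2_eq_square algebra_simps)
      then show ?thesis by simp
    qed simp
  qed
  have dist': "of_nat k \<noteq> complex_of_real \<theta>" "of_nat k \<noteq> complex_of_real \<tau>" "complex_of_real \<theta> \<noteq> complex_of_real \<tau>"
    using dist by (metis of_real_eq_iff of_real_of_nat_eq)+
  interpret h: map_poly_inj_idom_divide_hom complex_of_real ..
  define g where "g e = (e - of_nat k) * (e - complex_of_real \<theta>)" for e
  have "eig_mult (adj_matrix v E) \<tau> = Polynomial.order (complex_of_real \<tau>) (map_poly complex_of_real (char_poly (adj_matrix v E)))"
    unfolding eig_mult_def by (simp only: h.order_hom)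
  also have "map_poly complex_of_real (char_poly (adj_matrix v E)) = char_poly A"
    unfolding hom[symmetric] by (rule of_real_hom.char_poly_hom[OF car, symmetric])
  also have "Polynomial.order (complex_of_real \<tau>) \<dots> = count_list es (complex_of_real \<tau>)"
    unfolding cp by (rule order_prod_linear)
  finally have m: "eig_mult (adj_matrix v E) \<tau> = count_list es (complex_of_real \<tau>)" .
  have "sum_list (map g es) = of_nat (eig_mult (adj_matrix v E) \<tau>) * g (complex_of_real \<tau>)"
    unfolding sum_list_three_values[OF set dist'] m by (simp add: g_def)
  moreover have "sum_list (map g es) = sum_list (map (\<lambda>e. e * e) es) - (of_nat k + complex_of_real \<theta>) * sum_list es
      + of_nat v * (of_nat k * complex_of_real \<theta>)"
    unfolding len[symmetric] by (induction es) (simp_all add: g_def algebra_simps)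
  moreover have "sum_list es = 0"
  proof -
    have "mtrace A = 0"
      using srg by (simp add: mtrace_def A_def strongly_regular_def simple_graph_def)
    then show ?thesis using mtrace_complex_eigenvalues(1)[OF A cp] by simp
  qed
  moreover have "sum_list (map (\<lambda>e. e * e) es) = of_nat v * of_nat k"
  proof -
    have "mtrace (A * A) = (\<Sum>x<v. \<Sum>y<v. of_bool (E x y) * of_bool (E y x))"
      by (simp add: mtrace_def A_def scalar_prod_def atLeast0LessThan)
    also have "\<dots> = (\<Sum>x<v. \<Sum>y<v. of_bool (E x y))"
      using srg by (intro sum.cong refl) (auto simp: strongly_regular_def simple_graph_def)
    also have "\<dots> = of_nat v * of_nat k" by (simp add: srg_degree)
    finally show ?thesis using mtrace_complex_eigenvalues(2)[OF A cp] by simp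
  qed
  ultimately have "of_nat (eig_mult (adj_matrix v E) \<tau>) * g (complex_of_real \<tau>) = of_nat v * of_nat k * (1 + complex_of_real \<theta>)"
    by (simp add: algebra_simps)
  then have "complex_of_real (real (eig_mult (adj_matrix v E) \<tau>) * ((\<tau> - real k) * (\<tau> - \<theta>))) = complex_of_real (real v * real k * (1 + \<theta>))"
    by (simp add: g_def)
  then show ?thesis by (simp only: of_real_eq_iff)
qed

end

text \<open>Here q = 2r + 1, and \<open>\<kappa>\<close> is (q^2 + 1)/2. The eigenvalues r and
  -\<kappa> fix lam - mu and k - mu; the walk count then leaves two candidates for k, and the
  multiplicity condition excludes the wrong one.\<close>

lemma taylor_parameters:
  fixes r v k lam mu :: nat and E :: "nat \<Rightarrow> nat \<Rightarrow> bool"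
  defines "\<kappa> \<equiv> 2 * (real r)\<^sup>2 + 2 * real r + 1"
  assumes "r > 0" and v: "v = (2 * r + 2) * (4 * r\<^sup>2 + 2 * r + 1)"
    and srg: "strongly_regular v E k lam mu"
    and eig: "eigenvalue (adj_matrix v E) (real r)" "eigenvalue (adj_matrix v E) (- \<kappa>)"
    and mult: "real v * \<kappa> = real (eig_mult (adj_matrix v E) (- \<kappa>)) * (\<kappa> + real k)"
  shows "k = (2 * r + 1) * (2 * r\<^sup>2 + 2 * r + 1)" "mu = (2 * r\<^sup>2 + 2 * r + 1) * (r + 1)"
    "lam = (2 * r\<^sup>2 + 2 * r + 1) * r + r"
proof -
  define m where "m = eig_mult (adj_matrix v E) (- \<kappa>)"
  have rp: "real r > 0" using \<open>r > 0\<close> by simp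
  have kp: "\<kappa> > 0" using rp by (simp add: \<kappa>_def add_pos_pos)
  have vr: "real v = (2 * real r + 2) * (4 * (real r)\<^sup>2 + 2 * real r + 1)" by (simp add: v algebra_simps)
  have adj: "adj_matrix v E = mat v v (\<lambda>(i, j). of_bool (E i j))"
    by (rule eq_matI) (auto simp: adj_matrix_def)
  have "real k \<noteq> real r"
  proof
    assume k: "real k = real r"
    let ?K = "2 * r\<^sup>2 + 2 * r + 1" and ?c = "4 * r\<^sup>2 + 2 * r + 1"
    have "real (2 * ?c * ?K) * real (r + 1) = real (m * (2 * r + 1)) * real (r + 1)"
      using mult unfolding k vr m_def[symmetric] by (simp add: \<kappa>_def power2_eq_square algebra_simps)
    then have "real (2 * ?c * ?K) = real (m * (2 * r + 1))"
      by (rule mult_right_cancel[THEN iffD1, rotated]) simp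
    then have e: "2 * ?c * ?K = m * (2 * r + 1)" by (simp only: of_nat_eq_iff)
    \<comment> \<open>If k = r, the multiplicity condition makes 2r + 1 divide 2 c K, which however
      leaves remainder 1. With k = r excluded, both r and -\<kappa> are roots of the eigenvalue
      quadratic.\<close>
    have "2 * ?c * ?K = (2 * r + 1) * (8 * r ^ 3 + 8 * r\<^sup>2 + 6 * r + 1) + 1"
      by (simp add: power2_eq_square power3_eq_cube algebra_simps)
    then have "m * (2 * r + 1) = (8 * r ^ 3 + 8 * r\<^sup>2 + 6 * r + 1) * (2 * r + 1) + 1"
      using e by (simp only: mult.commute)
    then have "2 * r + 1 dvd (8 * r ^ 3 + 8 * r\<^sup>2 + 6 * r + 1) * (2 * r + 1) + 1"
      by (metis dvd_triv_right)
    then have "2 * r + 1 dvd 1" by (simp only: dvd_add_right_iff dvd_triv_right)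
    then show False using \<open>r > 0\<close> by simp
  qed
  note dist = this
  have dist': "real k \<noteq> - \<kappa>" "real r \<noteq> - \<kappa>" using kp rp by linarith+
  have q1: "(real r)\<^sup>2 = (real lam - real mu) * real r + (real k - real mu)"
    using srg_adj_eigenvalue[OF srg, of "real r"] eig(1) dist by (simp add: adj)
  have q2: "\<kappa>\<^sup>2 = (real lam - real mu) * (- \<kappa>) + (real k - real mu)"
    using srg_adj_eigenvalue[OF srg, of "- \<kappa>"] eig(2) dist' by (simp add: adj)
  have "(real r + \<kappa>) * (real lam - real mu) = (real r + \<kappa>) * (real r - \<kappa>)"
    using q1 q2 by (simp add: power2_eq_square algebra_simps)
  then have lin: "real lam - real mu = real r - \<kappa>" using rp kp by simp
  have const: "real k - real mu = real r * \<kappa>"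
    using q1 unfolding lin by (simp add: power2_eq_square algebra_simps)
  have "(real k)\<^sup>2 = (real r - \<kappa>) * real k + real v * (real k - real r * \<kappa>) + real r * \<kappa>"
    using srg_parameter_identity[OF srg, where 'a = real] const \<open>r > 0\<close> unfolding lin by (simp add: v)
  \<comment> \<open>The walk count is quadratic in k; its roots are q \<kappa> and q^2 r.\<close>
  then have "(real k - (2 * real r + 1) * \<kappa>) * (real k - (2 * real r + 1)\<^sup>2 * real r) = 0"
    unfolding vr \<kappa>_def by (simp add: power2_eq_square algebra_simps)
  moreover have "real k \<noteq> (2 * real r + 1)\<^sup>2 * real r"
  proof
    assume k: "real k = (2 * real r + 1)\<^sup>2 * real r"
    \<comment> \<open>For the unwanted root the multiplicity condition therefore gives m = 2
      \<kappa>. The trace formula then forces \<kappa> = (2r + 1) r, but these differ by r +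
      1.\<close>
    have v2: "\<kappa> + real k = real v / 2"
      unfolding k vr \<kappa>_def by (simp add: power2_eq_square field_simps)
    have "v > 0" unfolding v by simp
    then have vpos: "real v > 0" by simp
    have m: "real m = 2 * \<kappa>" using mult vpos unfolding v2 m_def[symmetric] by (simp add: field_simps)
    have "real m * ((- \<kappa> - real k) * (- \<kappa> - real r)) = real v * real k * (1 + real r)"
      unfolding m_def using srg_multiplicity_trace[OF srg, of "real r" "- \<kappa>"] lin const dist dist' by simp
    moreover have "(- \<kappa> - real k) * (- \<kappa> - real r) = real v / 2 * (\<kappa> + real r)"
      unfolding v2[symmetric] by (simp add: algebra_simps)
    ultimately have "real v * (\<kappa> * (\<kappa> + real r)) = real v * (real k * (1 + real r))"
      by (simp add: m)
    then have "\<kappa> * (\<kappa> + real r) = real k * (1 + real r)" using vpos by simp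
    then have "(2 * real r + 1) * (real r + 1) * (\<kappa> - (2 * real r + 1) * real r) = 0"
      unfolding k by (simp add: \<kappa>_def power2_eq_square algebra_simps)
    then have "\<kappa> - (2 * real r + 1) * real r = 0" using rp by auto
    then show False using rp by (simp add: \<kappa>_def power2_eq_square algebra_simps)
  qed
  ultimately have k: "real k = (2 * real r + 1) * \<kappa>" by simp
  have "real k = real ((2 * r + 1) * (2 * r\<^sup>2 + 2 * r + 1))"
    unfolding k by (simp add: \<kappa>_def algebra_simps)
  then show "k = (2 * r + 1) * (2 * r\<^sup>2 + 2 * r + 1)" by (simp only: of_nat_eq_iff)
  have mu: "real mu = \<kappa> * (real r + 1)" using const unfolding k by (simp add: algebra_simps)
  have "real mu = real ((2 * r\<^sup>2 + 2 * r + 1) * (r + 1))"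
    unfolding mu by (simp add: \<kappa>_def algebra_simps)
  then show "mu = (2 * r\<^sup>2 + 2 * r + 1) * (r + 1)" by (simp only: of_nat_eq_iff)
  have "real lam = real ((2 * r\<^sup>2 + 2 * r + 1) * r + r)"
    using lin unfolding mu by (simp add: \<kappa>_def algebra_simps)
  then show "lam = (2 * r\<^sup>2 + 2 * r + 1) * r + r" by (simp only: of_nat_eq_iff)
qed

section \<open>The design of a Delsarte coclique\<close>

text \<open>Writing q = 2r + 1 turns every parameter into a polynomial in \<open>r\<close> with
  natural coefficients, so no halving or truncated subtraction occurs.\<close>

locale taylor_graph =
  fixes v r lam :: nat and E :: "nat \<Rightarrow> nat \<Rightarrow> bool"
  assumes r_pos: "r > 0"
    and v_eq: "v = (2 * r + 2) * (4 * r\<^sup>2 + 2 * r + 1)"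
    and srg: "strongly_regular v E ((2 * r + 1) * (2 * r\<^sup>2 + 2 * r + 1)) lam ((2 * r\<^sup>2 + 2 * r + 1) * (r + 1))"
    and lam_eq: "lam = (2 * r\<^sup>2 + 2 * r + 1) * r + r"
begin

definition a :: "nat \<Rightarrow> nat \<Rightarrow> int" where
  "a x y = of_bool (E x y)"

text \<open>Integer versions of the parameters, so that counts may be subtracted: \<open>kap\<close>
  is (q^2 + 1)/2 and \<open>c\<close> is q^2 - q + 1.\<close>

definition R :: int where "R = int r"
definition q :: int where "q = 2 * R + 1"
definition kap :: int where "kap = 2 * R\<^sup>2 + 2 * R + 1"
definition c :: int where "c = 4 * R\<^sup>2 + 2 * R + 1"

lemma simple: "simple_graph v E"
  using srg by (simp add: strongly_regular_def)

lemma a_sym: "a x y = a y x"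
  using simple by (auto simp: a_def simple_graph_def)

lemma a_irrefl [simp]: "a x x = 0"
  using simple by (auto simp: a_def simple_graph_def)

lemma a_sq [simp]: "a x y * a x y = a x y"
  by (simp add: a_def)

lemma a_cases: "a x y = 0 \<or> a x y = 1"
  by (simp add: a_def)

lemma sum_a: "x < v \<Longrightarrow> (\<Sum>z<v. a x z) = q * kap"
proof -
  assume "x < v"
  then have "card (nbrs v E x) = (2 * r + 1) * (2 * r\<^sup>2 + 2 * r + 1)"
    using srg unfolding strongly_regular_def by blast
  then have "int (card (nbrs v E x)) = q * kap"
    by (simp add: q_def kap_def R_def algebra_simps)
  moreover have "{..<v} \<inter> {z. E x z} = nbrs v E x" by (auto simp: nbrs_def)
  ultimately show ?thesis by (simp add: a_def sum.If_cases of_bool_def)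
qed

lemma sum_a_a:
  assumes "x < v" "y < v" "x \<noteq> y"
  shows "(\<Sum>z<v. a x z * a y z) = kap * (R + 1) - (kap - R) * a x y"
proof -
  have "int (card (nbrs v E x \<inter> nbrs v E y)) = kap * (R + 1) - (kap - R) * a x y"
  proof (cases "E x y")
    case True
    then have "card (nbrs v E x \<inter> nbrs v E y) = lam"
      using srg assms unfolding strongly_regular_def by blast
    then show ?thesis using True by (simp add: kap_def R_def a_def lam_eq algebra_simps)
  next
    case False
    then have "card (nbrs v E x \<inter> nbrs v E y) = (2 * r\<^sup>2 + 2 * r + 1) * (r + 1)"
      using srg assms unfolding strongly_regular_def by blast
    then show ?thesis using False by (simp add: kap_def R_def a_def algebra_simps)
  qed
  moreover have "{..<v} \<inter> {z. E x z \<and> E y z} = nbrs v E x \<inter> nbrs v E y" by (auto simp: nbrs_def)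
  moreover have "a x z * a y z = (if E x z \<and> E y z then 1 else 0)" for z by (simp add: a_def)
  ultimately show ?thesis by (simp add: sum.If_cases)
qed

end

section \<open>Incidence between the points of a Delsarte coclique and the remaining vertices as
  blocks\<close>

locale taylor_coclique = taylor_graph +
  fixes C :: "nat set"
  assumes coclique: "coclique v E C"
    and card_C: "card C = 4 * r\<^sup>2 + 2 * r + 1"
begin

definition B :: "nat set" where "B = {..<v} - C"

lemma C_lt: "x \<in> C \<Longrightarrow> x < v"
  using coclique by (auto simp: coclique_def)

lemma B_lt: "x \<in> B \<Longrightarrow> x < v"
  by (auto simp: B_def)

lemma finite_C [simp]: "finite C"
  using coclique finite_subset by (auto simp: coclique_def)

lemma finite_B [simp]: "finite B"
  by (simp add: B_def)

lemma a_C [simp]: "x \<in> C \<Longrightarrow> y \<in> C \<Longrightarrow> a x y = 0"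
  using coclique by (auto simp: coclique_def a_def)

lemma int_card_C: "int (card C) = c"
  by (simp add: card_C c_def R_def)

lemma int_card_B: "int (card B) = q * c"
proof -
  have "card B = card {..<v} - card C"
    unfolding B_def by (rule card_Diff_subset) (use C_lt in auto)
  then show ?thesis
    by (simp add: card_C v_eq q_def c_def R_def algebra_simps of_nat_diff)
qed

lemma sum_split: "(\<Sum>z<v. f z) = (\<Sum>z\<in>C. f z) + (\<Sum>z\<in>B. f z)" for f :: "nat \<Rightarrow> int"
proof -
  have "{..<v} = C \<union> B" using C_lt by (auto simp: B_def)
  moreover have "sum f (C \<union> B) = sum f C + sum f B" by (rule sum.union_disjoint) (auto simp: B_def)
  ultimately show ?thesis by simp
qed

lemma sum_B: "x \<in> C \<Longrightarrow> (\<Sum>z\<in>B. a x z) = q * kap"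
  using sum_a[OF C_lt] by (simp add: sum_split)

text \<open>All neighbours of a vertex of \<open>C\<close> lie in \<open>B\<close>, so the counts in
  the whole graph are counts of blocks. The diagonal uses q = R + (R + 1).\<close>

lemma sum_B_B:
  assumes "x \<in> C" "y \<in> C"
  shows "(\<Sum>z\<in>B. a x z * a y z) = (if x = y then kap * R else 0) + kap * (R + 1)"
proof (cases "x = y")
  case True
  then show ?thesis using sum_B[OF assms(1)] by (simp add: q_def algebra_simps)
next
  case False
  then show ?thesis using sum_a_a[OF C_lt[OF assms(1)] C_lt[OF assms(2)]] assms by (simp add: sum_split)
qed

text \<open>Equality in the Hoffman bound: the number of neighbours in \<open>C\<close> has variance zero on \<open>B\<close>.\<close>

lemma sum_C:
  assumes "y \<in> B"
  shows "(\<Sum>x\<in>C. a x y) = kap"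
proof -
  define d where "d y = (\<Sum>x\<in>C. a x y)" for y
  have s1: "(\<Sum>y\<in>B. d y) = c * (q * kap)"
    unfolding d_def by (subst sum.swap) (simp add: sum_B int_card_C)
  have "(\<Sum>y\<in>B. (d y)\<^sup>2) = (\<Sum>x\<in>C. \<Sum>x'\<in>C. \<Sum>y\<in>B. a x y * a x' y)"
    unfolding d_def power2_eq_square sum_product by (subst sum.swap, subst (2) sum.swap) (rule refl)
  also have "\<dots> = (\<Sum>x\<in>C. kap * R + c * (kap * (R + 1)))"
    by (intro sum.cong refl) (simp add: sum_B_B sum.distrib int_card_C)
  also have "\<dots> = c * (kap * R + c * (kap * (R + 1)))"
    by (simp add: int_card_C)
  finally have s2: "(\<Sum>y\<in>B. (d y)\<^sup>2) = c * (kap * R + c * (kap * (R + 1)))" .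
  have "(\<Sum>y\<in>B. (d y - kap)\<^sup>2) = (\<Sum>y\<in>B. (d y)\<^sup>2) - 2 * kap * (\<Sum>y\<in>B. d y) + q * c * kap\<^sup>2"
    by (simp add: power2_diff sum.distrib sum_subtractf sum_distrib_left int_card_B algebra_simps)
  also have "\<dots> = 0"
    unfolding s1 s2 c_def q_def kap_def by (simp add: power2_eq_square algebra_simps)
  finally have "(d y - kap)\<^sup>2 = 0"
    using assms by (subst (asm) sum_nonneg_eq_0_iff) auto
  then show ?thesis by (simp add: d_def)
qed

lemma sum_C_sum_B:
  fixes f :: "nat \<Rightarrow> nat \<Rightarrow> int"
  shows "(\<Sum>z\<in>B. \<Sum>x\<in>C. a x y * f x z) = (\<Sum>x\<in>C. a x y * (\<Sum>z\<in>B. f x z))"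
  by (subst sum.swap) (simp add: sum_distrib_left)

text \<open>Again a sum of squares vanishes: as \<open>|C|\<close> equals the multiplicity of the smallest
  eigenvalue, the graph on \<open>B\<close> is determined by its incidences with \<open>C\<close>.\<close>

lemma block_intersection:
  assumes y: "y \<in> B" and z: "z \<in> B"
  shows "(\<Sum>x\<in>C. a x y * a x z) = (R + 1)\<^sup>2 - R * a y z + (if y = z then R\<^sup>2 else 0)"
proof (cases "y = z")
  case True
  then show ?thesis using sum_C[OF y] by (simp add: kap_def power2_eq_square algebra_simps)
next
  case False
  define n where "n z = (\<Sum>x\<in>C. a x y * a x z)" for z
  have s1: "(\<Sum>z\<in>B. n z) = kap * (q * kap)"
    unfolding n_def sum_C_sum_B using sum_C[OF y] by (simp add: sum_B flip: sum_distrib_right)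
  have nC: "(\<Sum>x'\<in>C. a x' y * (\<Sum>z\<in>B. a x z * a x' z)) = a x y * (kap * R) + kap * (kap * (R + 1))"
    if "x \<in> C" for x
  proof -
    have "(\<Sum>x'\<in>C. a x' y * (\<Sum>z\<in>B. a x z * a x' z)) =
        (\<Sum>x'\<in>C. (if x = x' then a x y * (kap * R) else 0) + a x' y * (kap * (R + 1)))"
      using that by (intro sum.cong refl) (simp add: sum_B_B algebra_simps)
    also have "\<dots> = a x y * (kap * R) + (\<Sum>x'\<in>C. a x' y) * (kap * (R + 1))"
      using that by (simp add: sum.distrib sum_distrib_right)
    finally show ?thesis by (simp add: sum_C[OF y])
  qed
  have "(\<Sum>z\<in>B. (n z)\<^sup>2) = (\<Sum>z\<in>B. \<Sum>x\<in>C. a x y * (\<Sum>x'\<in>C. a x' y * (a x z * a x' z)))"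
    by (simp add: n_def power2_eq_square sum_product sum_distrib_left mult_ac)
  also have "\<dots> = (\<Sum>x\<in>C. a x y * (\<Sum>x'\<in>C. a x' y * (\<Sum>z\<in>B. a x z * a x' z)))"
    unfolding sum_C_sum_B ..
  also have "\<dots> = (\<Sum>x\<in>C. a x y * (kap * R + kap * (kap * (R + 1))))"
  proof (intro sum.cong refl)
    fix x assume "x \<in> C"
    show "a x y * (\<Sum>x'\<in>C. a x' y * (\<Sum>z\<in>B. a x z * a x' z)) = a x y * (kap * R + kap * (kap * (R + 1)))"
      unfolding nC[OF \<open>x \<in> C\<close>] using a_cases[of x y] by auto
  qed
  also have "\<dots> = kap * (kap * R + kap * (kap * (R + 1)))"
    by (simp add: sum_C[OF y] flip: sum_distrib_right)
  finally have s2: "(\<Sum>z\<in>B. (n z)\<^sup>2) = kap * (kap * R + kap * (kap * (R + 1)))" .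
  have s3: "(\<Sum>z\<in>B. a y z) = q * kap - kap"
    using sum_a[OF B_lt[OF y]] sum_C[OF y] by (simp add: sum_split a_sym[of y])
  have "(\<Sum>z\<in>B. a y z * n z) = (\<Sum>z\<in>B. \<Sum>x\<in>C. a x y * (a x z * a y z))"
    by (simp add: n_def sum_distrib_left mult_ac)
  also have "\<dots> = (\<Sum>x\<in>C. a x y * (\<Sum>z\<in>B. a x z * a y z))"
    by (rule sum_C_sum_B)
  also have "\<dots> = (\<Sum>x\<in>C. a x y * (kap * R + R))"
  proof (intro sum.cong refl)
    fix x assume x: "x \<in> C"
    have "x \<noteq> y" using x y by (auto simp: B_def)
    then have "(\<Sum>z\<in>B. a x z * a y z) = kap * (R + 1) - (kap - R) * a x y"
      using sum_a_a[OF C_lt[OF x] B_lt[OF y]] x by (simp add: sum_split)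
    then show "a x y * (\<Sum>z\<in>B. a x z * a y z) = a x y * (kap * R + R)"
      using a_cases[of x y] by (auto simp: algebra_simps)
  qed
  also have "\<dots> = kap * (kap * R + R)"
    by (simp add: sum_C[OF y] flip: sum_distrib_right)
  finally have s4: "(\<Sum>z\<in>B. a y z * n z) = kap * (kap * R + R)" .
  have s5: "(\<Sum>z\<in>B. a y z * a y z) = q * kap - kap" using s3 by simp
  \<comment> \<open>The deviation from the claimed value when z differs from y. The sums computed
    above give total square R^4 over \<open>B\<close>, which the term z = y alone already supplies,
    so every other term is 0.\<close>
  define D where "D z = R * a y z + n z - (R + 1)\<^sup>2" for z
  have "D y = R\<^sup>2"
    using sum_C[OF y] by (simp add: D_def n_def kap_def power2_eq_square algebra_simps)
  have "(\<Sum>z\<in>B. (D z)\<^sup>2) = R\<^sup>2 * (\<Sum>z\<in>B. a y z * a y z) + (\<Sum>z\<in>B. (n z)\<^sup>2) + q * c * (R + 1)^4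
     + 2 * R * (\<Sum>z\<in>B. a y z * n z) - 2 * R * (R + 1)\<^sup>2 * (\<Sum>z\<in>B. a y z) - 2 * (R + 1)\<^sup>2 * (\<Sum>z\<in>B. n z)"
    unfolding int_card_B[symmetric] sum_constant[symmetric] sum_distrib_left sum_distrib_right
      sum.distrib[symmetric] sum_subtractf[symmetric]
  proof (intro sum.cong refl)
    fix z
    show "(D z)\<^sup>2 = R\<^sup>2 * (a y z * a y z) + (n z)\<^sup>2 + (R + 1) ^ 4 + 2 * R * (a y z * n z)
        - 2 * R * (R + 1)\<^sup>2 * a y z - 2 * (R + 1)\<^sup>2 * n z"
      using a_cases[of y z] by (auto simp: D_def power2_eq_square power4_eq_xxxx algebra_simps)
  qed
  also have "\<dots> = (R\<^sup>2)\<^sup>2"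
    unfolding s1 s2 s3 s4 s5 kap_def q_def c_def by (simp add: power2_eq_square power4_eq_xxxx algebra_simps)
  finally have "(\<Sum>z\<in>B - {y}. (D z)\<^sup>2) = 0"
    using y \<open>D y = R\<^sup>2\<close> by (simp add: sum_diff1)
  then have "(D z)\<^sup>2 = 0"
    using z False by (subst (asm) sum_nonneg_eq_0_iff) auto
  then show ?thesis using False by (simp add: D_def n_def)
qed

end

text \<open>The blocks in C2 - C1 are pairwise non-adjacent, so any two meet in (R + 1)^2 points of
  C1, while each point of C1 - C2 lies on \<open>kap\<close> of them. Counting incidences with the
  points of one fixed block gives |C2 - C1| (R + 1)^2 + R^2 = kap^2, an arithmetic restriction on
  R.\<close>

lemma (in taylor_graph) two_cocliques_imp_r_eq_1:
  assumes "taylor_coclique v r lam E C1" "taylor_coclique v r lam E C2" "C1 \<noteq> C2"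
  shows "r = 1"
proof -
  interpret c1: taylor_coclique v r lam E C1 by fact
  interpret c2: taylor_coclique v r lam E C2 by fact
  define D where "D = C2 - C1"
  have "finite D" by (simp add: D_def)
  have "D \<noteq> {}"
    using card_subset_eq[OF c1.finite_C, of C2] c1.card_C c2.card_C assms(3) by (auto simp: D_def)
  then obtain y where y: "y \<in> D" by blast
  have DB: "z \<in> c1.B" if "z \<in> D" for z
    using that c2.C_lt by (auto simp: D_def c1.B_def)
  \<comment> \<open>The factor \<open>a x y\<close> discards the points of C1 that lie in C2. A
    remaining x is a block for C2, and its neighbours in C2 all avoid C1.\<close>
  have deg: "a x y * (\<Sum>z\<in>D. a x z) = a x y * kap" if x: "x \<in> C1" for x
  proof (cases "x \<in> C2")
    case True
    then have "a x y = 0" using y by (simp add: D_def)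
    then show ?thesis by simp
  next
    case False
    then have "x \<in> c2.B" using c1.C_lt[OF x] by (simp add: c2.B_def)
    have "(\<Sum>z\<in>D. a x z) = (\<Sum>z\<in>C2. a x z)"
      by (rule sum.mono_neutral_left) (use x in \<open>auto simp: D_def\<close>)
    also have "\<dots> = kap"
      using c2.sum_C[OF \<open>x \<in> c2.B\<close>] by (simp add: a_sym[of x])
    finally show ?thesis by simp
  qed
  have "(\<Sum>z\<in>D. \<Sum>x\<in>C1. a x y * a x z) = (\<Sum>x\<in>C1. a x y * (\<Sum>z\<in>D. a x z))"
    by (subst sum.swap) (simp add: sum_distrib_left)
  also have "\<dots> = (\<Sum>x\<in>C1. a x y) * kap"
    by (simp add: deg sum_distrib_right)
  also have "\<dots> = kap * kap" using c1.sum_C[OF DB[OF y]] by simp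
  finally have e: "(\<Sum>z\<in>D. \<Sum>x\<in>C1. a x y * a x z) = kap * kap" .
  have "(\<Sum>z\<in>D. \<Sum>x\<in>C1. a x y * a x z) = (\<Sum>z\<in>D. (R + 1)\<^sup>2 + (if y = z then R\<^sup>2 else 0))"
    using y by (intro sum.cong refl) (auto simp: c1.block_intersection[OF DB[OF y] DB] D_def)
  also have "\<dots> = int (card D) * (R + 1)\<^sup>2 + R\<^sup>2"
    using y \<open>finite D\<close> by (simp add: sum.distrib)
  finally have "int (card D) * (R + 1)\<^sup>2 = kap * kap - R\<^sup>2" using e by simp
  \<comment> \<open>Uses kap^2 - R^2 = (kap - R)(kap + R) with kap + R = (R + 1)(2R + 1). After
    cancelling R + 1, the right side is -2 modulo R + 1.\<close>
  then have "(R + 1) * (int (card D) * (R + 1)) = (R + 1) * ((2 * R\<^sup>2 + R + 1) * (2 * R + 1))"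
    by (simp add: kap_def power2_eq_square algebra_simps)
  then have "int (card D) * (R + 1) = (2 * R\<^sup>2 + R + 1) * (2 * R + 1)"
    using r_pos by (simp add: R_def)
  then have "2 = (R + 1) * (4 * R\<^sup>2 + 3 - int (card D))"
    by (simp add: power2_eq_square algebra_simps)
  then have "R + 1 dvd 2" by (rule dvdI)
  then have "R + 1 \<le> 2" by (rule zdvd_imp_le) simp
  then show ?thesis using r_pos by (simp add: R_def)
qed

section \<open>The code spanned by the extended blocks\<close>

lemma even_sum_symmetric:
  fixes f :: "'a \<Rightarrow> 'a \<Rightarrow> int"
  assumes "finite B" and sym: "\<And>x y. f x y = f y x" and diag: "\<And>x. f x x = 0"
  shows "even (\<Sum>x\<in>B. \<Sum>y\<in>B. f x y)"
  using \<open>finite B\<close>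
proof (induction B rule: finite_induct)
  case (insert b B)
  have "(\<Sum>x\<in>insert b B. \<Sum>y\<in>insert b B. f x y) = 2 * (\<Sum>y\<in>B. f b y) + (\<Sum>x\<in>B. \<Sum>y\<in>B. f x y)"
    using insert.hyps by (simp add: diag sum.distrib sym[of _ b])
  then show ?case using insert.IH by simp
qed simp

context taylor_coclique
begin

text \<open>Instantiates the self-dual code argument with the extended blocks, leaving the
  arithmetic of \<open>m\<close> to two hypotheses. \<open>iso\<close> concerns the values R (R s -
  2 t) of the form on the code. \<open>norm\<close> concerns its value F on a dual word, constrained
  by the first and second moments, over all blocks, of the multiples of m that the word
  produces.\<close>

lemma gauss_sum_power_positive:
  fixes \<omega> :: complex and m :: int
  assumes "m > 0"
    and ord: "\<And>j. \<omega> powi (2 * j) = 1 \<longleftrightarrow> m dvd j"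
    and sq: "\<omega> powi (m\<^sup>2) = 1"
    and iso: "\<And>s t. \<omega> powi (R * (R * s - 2 * t)) = 1"
    and norm: "\<And>F d s S S2. even (S + S2) \<Longrightarrow> q * kap * d = m * S - q * R * s \<Longrightarrow>
      kap * R * F = m\<^sup>2 * S2 - kap * (R + 1) * d\<^sup>2 + R\<^sup>2 * s\<^sup>2 \<Longrightarrow> \<omega> powi F = 1"
  shows "\<exists>N>0. (\<Sum>t\<in>{0..<m}. \<omega> powi (t\<^sup>2)) ^ card C * (\<Sum>t\<in>{0..<m}. \<omega> powi (- t\<^sup>2)) = of_nat N"
proof -
  \<comment> \<open>\<open>None\<close> is the extra coordinate. Its entry R + 1 with sign -1
    cancels the constant (R + 1)^2 in the block intersections, so the Gram matrix becomes R^2 I - R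
    A on \<open>B\<close>.\<close>
  define P where "P = insert None (Some ` C)"
  define \<epsilon> :: "nat option \<Rightarrow> int" where "\<epsilon> p = (case p of None \<Rightarrow> -1 | Some _ \<Rightarrow> 1)" for p
  define M where "M p y = (case p of None \<Rightarrow> R + 1 | Some x \<Rightarrow> a x y)" for p y
  have sumP: "(\<Sum>p\<in>P. f p) = f None + (\<Sum>x\<in>C. f (Some x))" for f :: "nat option \<Rightarrow> int"
    unfolding P_def by (subst sum.insert) (auto simp: sum.reindex)
  have prodP: "(\<Prod>p\<in>P. f p) = f None * (\<Prod>x\<in>C. f (Some x))" for f :: "nat option \<Rightarrow> complex"
    unfolding P_def by (subst prod.insert) (auto simp: prod.reindex)
  have gram: "(\<Sum>p\<in>P. \<epsilon> p * (M p y * M p z)) = (if y = z then R\<^sup>2 else 0) - R * a y z"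
    if "y \<in> B" "z \<in> B" for y z
    using block_intersection[OF that] by (simp add: sumP \<epsilon>_def M_def power2_eq_square algebra_simps)
  have "\<exists>N>0. (\<Prod>p\<in>P. \<Sum>t\<in>{0..<m}. \<omega> powi (\<epsilon> p * t\<^sup>2)) = of_nat N"
  proof (rule gauss_sum_product_self_dual[OF _ finite_B \<open>m > 0\<close> ord sq, where M = M])
    show "finite P" by (simp add: P_def)
  next
    fix z :: "nat \<Rightarrow> int"
    \<comment> \<open>Off-diagonal terms occur in equal pairs. The resulting factor 2 matters for m
      = 2, where the form must vanish modulo 4.\<close>
    obtain T where T: "(\<Sum>y\<in>B. \<Sum>y'\<in>B. a y y' * z y * z y') = 2 * T"
      using even_sum_symmetric[of B "\<lambda>y y'. a y y' * z y * z y'"] by (auto simp: a_sym mult_ac elim!: evenE)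
    have "(\<Sum>p\<in>P. \<epsilon> p * (\<Sum>y\<in>B. M p y * z y)\<^sup>2) = 
        (\<Sum>p\<in>P. \<Sum>y\<in>B. \<Sum>y'\<in>B. z y * z y' * (\<epsilon> p * (M p y * M p y')))"
      by (simp add: power2_eq_square sum_product sum_distrib_left mult_ac)
    also have "\<dots> = (\<Sum>y\<in>B. \<Sum>y'\<in>B. z y * z y' * (\<Sum>p\<in>P. \<epsilon> p * (M p y * M p y')))"
      unfolding sum_distrib_left by (subst sum.swap, intro sum.cong refl, rule sum.swap)
    also have "\<dots> = (\<Sum>y\<in>B. \<Sum>y'\<in>B. (if y = y' then R\<^sup>2 * (z y)\<^sup>2 else 0) - R * (a y y' * z y * z y'))"
      by (intro sum.cong refl) (simp add: gram algebra_simps power2_eq_square)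
    also have "\<dots> = (\<Sum>y\<in>B. R\<^sup>2 * (z y)\<^sup>2) - R * (2 * T)"
      by (simp add: sum_subtractf T flip: sum_distrib_left)
    also have "\<dots> = R * (R * (\<Sum>y\<in>B. (z y)\<^sup>2) - 2 * T)"
      by (simp add: power2_eq_square algebra_simps flip: sum_distrib_left)
    finally show "\<omega> powi (\<Sum>p\<in>P. \<epsilon> p * (\<Sum>y\<in>B. M p y * z y)\<^sup>2) = 1" using iso by simp
  next
    fix x :: "nat option \<Rightarrow> int"
    assume *: "\<forall>y\<in>B. m dvd (\<Sum>p\<in>P. \<epsilon> p * M p y * x p)"
    define f where "f i = x (Some i)" for i
    define s where "s = x None"
    \<comment> \<open>Lifts the congruences defining the dual code to integer equations, with
      quotients w y whose sum and sum of squares enter \<open>norm\<close>.\<close>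
    have "\<forall>y\<in>B. \<exists>w. (\<Sum>i\<in>C. a i y * f i) = (R + 1) * s + m * w"
      using * by (force simp: sumP \<epsilon>_def M_def f_def s_def dvd_def algebra_simps)
    then obtain w where w: "\<And>y. y \<in> B \<Longrightarrow> (\<Sum>i\<in>C. a i y * f i) = (R + 1) * s + m * w y"
      by metis
    define \<sigma> where "\<sigma> = (\<Sum>i\<in>C. f i)"
    define F where "F = (\<Sum>i\<in>C. (f i)\<^sup>2) - s\<^sup>2"
    define S where "S = (\<Sum>y\<in>B. w y)"
    define S2 where "S2 = (\<Sum>y\<in>B. (w y)\<^sup>2)"
    have "(\<Sum>y\<in>B. \<Sum>i\<in>C. a i y * f i) = q * kap * \<sigma>"
      by (subst sum.swap) (simp add: sum_B \<sigma>_def sum_distrib_left flip: sum_distrib_right)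
    then have e1: "q * kap * \<sigma> = q * c * (R + 1) * s + m * S"
      by (simp add: w S_def sum.distrib int_card_B mult.assoc flip: sum_distrib_left)
    have "(\<Sum>y\<in>B. (\<Sum>i\<in>C. a i y * f i)\<^sup>2) = (\<Sum>y\<in>B. \<Sum>i\<in>C. \<Sum>j\<in>C. f i * f j * (a i y * a j y))"
      by (simp add: power2_eq_square sum_product mult_ac)
    also have "\<dots> = (\<Sum>i\<in>C. \<Sum>j\<in>C. f i * f j * (\<Sum>y\<in>B. a i y * a j y))"
      unfolding sum_distrib_left by (rule trans[OF sum.swap], rule sum.cong[OF refl], rule sum.swap)
    also have "\<dots> = (\<Sum>i\<in>C. \<Sum>j\<in>C. (if i = j then kap * R * (f i)\<^sup>2 else 0) + kap * (R + 1) * (f i * f j))"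
      by (intro sum.cong refl) (simp add: sum_B_B algebra_simps power2_eq_square)
    also have "\<dots> = kap * R * (\<Sum>i\<in>C. (f i)\<^sup>2) + kap * (R + 1) * \<sigma>\<^sup>2"
      unfolding \<sigma>_def power2_eq_square sum_product by (simp add: sum.distrib sum_distrib_left)
    finally have "kap * R * (\<Sum>i\<in>C. (f i)\<^sup>2) + kap * (R + 1) * \<sigma>\<^sup>2 = (\<Sum>y\<in>B. ((R + 1) * s + m * w y)\<^sup>2)"
      by (simp add: w)
    also have "\<dots> = q * c * ((R + 1) * s)\<^sup>2 + 2 * ((R + 1) * s) * (m * S) + m\<^sup>2 * S2"
    proof -
      have "(\<Sum>y\<in>B. ((R + 1) * s + m * w y)\<^sup>2) =
          (\<Sum>y\<in>B. ((R + 1) * s)\<^sup>2 + 2 * ((R + 1) * s) * m * w y + m\<^sup>2 * (w y)\<^sup>2)"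
        by (intro sum.cong refl) (simp add: power2_sum power_mult_distrib)
      then show ?thesis
        by (simp add: sum.distrib int_card_B S_def S2_def flip: sum_distrib_left)
    qed
    finally have e2: "kap * R * (\<Sum>i\<in>C. (f i)\<^sup>2) + kap * (R + 1) * \<sigma>\<^sup>2 =
      q * c * ((R + 1) * s)\<^sup>2 + 2 * ((R + 1) * s) * (m * S) + m\<^sup>2 * S2" .
    have "\<omega> powi F = 1"
    \<comment> \<open>Since c (R + 1) = q kap - R, the shift of \<sigma> by q s leaves only
      multiples of m and of R in the first moment.\<close>
    proof (rule norm[of S S2 "\<sigma> - q * s"])
      show "even (S + S2)"
        \<comment> \<open>Each w + w^2 is even.\<close>
        unfolding S_def S2_def sum.distrib[symmetric] by (rule dvd_sum) simp
      show "q * kap * (\<sigma> - q * s) = m * S - q * R * s"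
        using e1 by (simp add: q_def kap_def c_def power2_eq_square algebra_simps)
      have mS: "m * S = q * kap * \<sigma> - q * c * (R + 1) * s" using e1 by simp
      show "kap * R * F = m\<^sup>2 * S2 - kap * (R + 1) * (\<sigma> - q * s)\<^sup>2 + R\<^sup>2 * s\<^sup>2"
        using e2 unfolding mS by (simp add: F_def q_def kap_def c_def power2_eq_square algebra_simps)
    qed
    then show "\<omega> powi (\<Sum>p\<in>P. \<epsilon> p * (x p)\<^sup>2) = 1"
      by (simp add: sumP \<epsilon>_def F_def f_def s_def)
  qed
  then show ?thesis by (simp add: prodP \<epsilon>_def mult.commute)
qed

end

section \<open>Nonexistence from the sign of powers of Gauss sums\<close>

lemma cis_powi_eq_1_iff:
  fixes m :: nat
  assumes "m > 0"
  shows "cis (2 * pi / real m) powi j = 1 \<longleftrightarrow> int m dvd j"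
proof -
  have "cis (2 * pi / real m) powi j = cis (real_of_int j * (2 * pi / real m))"
    by (simp add: cis_power_int mult.commute)
  also have "\<dots> = 1 \<longleftrightarrow> cos (real_of_int j * (2 * pi / real m)) = 1"
  proof
    assume c: "cos (real_of_int j * (2 * pi / real m)) = 1"
    then have "sin (real_of_int j * (2 * pi / real m)) = 0" using cos_one_sin_zero by blast
    with c show "cis (real_of_int j * (2 * pi / real m)) = 1" by (simp add: complex_eq_iff)
  qed (simp add: complex_eq_iff)
  also have "\<dots> \<longleftrightarrow> (\<exists>n::int. real_of_int j * (2 * pi / real m) = real_of_int n * 2 * pi)"
    by (rule cos_one_2pi_int)
  also have "\<dots> \<longleftrightarrow> (\<exists>n::int. real_of_int j = real_of_int (int m * n))"
    using assms by (intro ex_cong1) (auto simp: field_simps)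
  also have "\<dots> \<longleftrightarrow> int m dvd j" by (auto simp: dvd_def simp del: of_int_mult)
  finally show ?thesis .
qed

lemma of_nat_neq_neg_power_mult:
  assumes "N > 0" "x > 0" "y > 0" "odd n"
  shows "(of_nat N :: complex) \<noteq> (- complex_of_real x) ^ n * complex_of_real y"
proof
  assume "(of_nat N :: complex) = (- complex_of_real x) ^ n * complex_of_real y"
  also have "\<dots> = complex_of_real (- (x ^ n * y))" using \<open>odd n\<close> by simp
  finally have "complex_of_real (real N) = complex_of_real (- (x ^ n * y))" by simp
  then have "real N = - (x ^ n * y)" by (simp only: of_real_eq_iff)
  moreover have "x ^ n * y > 0" using assms by simp
  ultimately show False using \<open>N > 0\<close> by linarith
qed

context taylor_coclique
begin

text \<open>The case q = 5 modulo 8, with m = 2 and \<omega> = i. The Gauss sum is 1 + i with fourth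
  power -4, and it enters to an odd power of that fourth power, so the product is negative instead
  of positive.\<close>

lemma r_mod_4_neq_2: "r mod 4 \<noteq> 2"
proof
  assume "r mod 4 = 2"
  define r' where "r' = r div 2"
  have r': "r = 2 * r'" "odd r'" using \<open>r mod 4 = 2\<close> unfolding r'_def by presburger+
  define k where "k = int r'"
  have R: "R = 2 * k" "odd k" using r' unfolding R_def k_def by simp_all
  have i2: "\<i> powi (2 * j) = 1 \<longleftrightarrow> 2 dvd j" for j
    by (cases "even j") (simp_all add: power_int_mult)
  have i4: "\<i> powi j = 1" if j: "4 dvd j" for j
  proof -
    obtain l where "j = 4 * l" using j by (elim dvdE)
    then show ?thesis using i2[of "2 * l"] by simp
  qed
  have "\<exists>N>0. (\<Sum>t\<in>{0..<2}. \<i> powi (t\<^sup>2)) ^ card C * (\<Sum>t\<in>{0..<2}. \<i> powi (- t\<^sup>2)) = of_nat N"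
  proof (rule gauss_sum_power_positive[OF _ i2])
    show "\<i> powi 2\<^sup>2 = 1" by (rule i4) simp
    show "\<i> powi (R * (R * s - 2 * t)) = 1" for s t
    proof (rule i4)
      have "R * (R * s - 2 * t) = 4 * (k * (k * s - t))" by (simp add: R algebra_simps)
      then show "4 dvd R * (R * s - 2 * t)" by simp
    qed
  next
    fix F d s S S2 :: int
    assume ev: "even (S + S2)" and e1: "q * kap * d = 2 * S - q * R * s"
      and e2: "kap * R * F = 2\<^sup>2 * S2 - kap * (R + 1) * d\<^sup>2 + R\<^sup>2 * s\<^sup>2"
    have odds: "odd q" "odd kap" by (simp_all add: q_def kap_def)
    have "even (q * kap * d)" unfolding e1 by (simp add: R)
    then obtain w where w: "d = 2 * w" using odds by (auto elim!: evenE)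
    have "q * kap * w = S - q * k * s" using e1 by (simp add: w R)
    then have "even (q * kap * w) \<longleftrightarrow> even (S - q * k * s)" by simp
    \<comment> \<open>Together with the parity of S + S2 this makes S2 + w + s even. That supplies
      the second factor 2 in kap k F, and hence 4 divides F because kap k is odd.\<close>
    then have "even w \<longleftrightarrow> even (S + s)" using odds R(2) by simp
    then have par: "even (S2 + w + s)" using ev by auto
    have "even (S2 - kap * (2 * k + 1) * w\<^sup>2 + k\<^sup>2 * s\<^sup>2)"
      using par odds R(2) by simp
    then obtain y where y: "S2 - kap * (2 * k + 1) * w\<^sup>2 + k\<^sup>2 * s\<^sup>2 = 2 * y" by (elim evenE)
    have "kap * k * F = 2 * (S2 - kap * (2 * k + 1) * w\<^sup>2 + k\<^sup>2 * s\<^sup>2)"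
      using e2 by (simp add: w R power_mult_distrib)
    then have "kap * k * F = 4 * y" unfolding y by simp
    then have "4 dvd kap * k * F" by simp
    moreover have "coprime 4 (kap * k)"
    proof -
      have "coprime (2 ^ 2) (kap * k)" using odds R(2) by (simp only: coprime_power_left_iff) simp
      then show ?thesis by simp
    qed
    ultimately have "4 dvd F" by (simp add: coprime_dvd_mult_right_iff)
    then show "\<i> powi F = 1" by (rule i4)
  qed simp
  then obtain N where N: "N > 0" 
    "(\<Sum>t\<in>{0..<2}. \<i> powi (t\<^sup>2)) ^ card C * (\<Sum>t\<in>{0..<2}. \<i> powi (- t\<^sup>2)) = of_nat N" by blast
  have two: "{0..<2::int} = {0, 1}" by auto
  have "card C = 4 * (r' * (2 * r + 1)) + 1"
    unfolding card_C r' by (simp add: power2_eq_square algebra_simps)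
  then have "(1 + \<i>) ^ card C * (1 - \<i>) = ((1 + \<i>) ^ 4) ^ (r' * (2 * r + 1)) * ((1 + \<i>) * (1 - \<i>))"
    by (simp only: power_add power_mult[of _ 4] power_one_right mult.assoc)
  also have "(1 + \<i>) ^ 4 = - complex_of_real 4"
    by (simp add: complex_eq_iff power4_eq_xxxx)
  also have "(1 + \<i>) * (1 - \<i>) = complex_of_real 2" by (simp add: complex_eq_iff)
  finally have "of_nat N = (- complex_of_real 4) ^ (r' * (2 * r + 1)) * complex_of_real 2"
    using N(2) by (simp add: two power_int_minus)
  then show False
    using of_nat_neq_neg_power_mult[of N 4 2 "r' * (2 * r + 1)"] N(1) r'(2) by simp
qed

text \<open>Here m is the odd power of p and \<omega> a primitive m-th root of unity. From g' = -g
  and g g' = m follows g^2 = -m, and |C| = 2 r (2r + 1) + 1 with r odd makes g^|C| g'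
  negative.\<close>

lemma r_neq_odd_prime_power_multiple:
  assumes p: "prime p" "p mod 4 = 3" and "odd l" "coprime l p"
  shows "r \<noteq> l * p ^ (2 * f + 1)"
proof
  assume r: "r = l * p ^ (2 * f + 1)"
  define m where "m = p ^ (2 * f + 1)"
  define \<omega> where "\<omega> = cis (2 * pi / real m)"
  have "odd p" using p(2) by presburger
  then have odd: "odd m" "odd r" using \<open>odd l\<close> by (simp_all add: m_def r)
  then have "m > 0" by (auto intro: Nat.gr0I)
  have ord: "\<omega> powi j = 1 \<longleftrightarrow> int m dvd j" for j
    unfolding \<omega>_def by (rule cis_powi_eq_1_iff[OF \<open>m > 0\<close>])
  have ord2: "\<omega> powi (2 * j) = 1 \<longleftrightarrow> int m dvd j" for j
    by (rule odd_ord_double[OF ord]) (use odd in simp)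
  have sq: "\<omega> powi ((int m)\<^sup>2) = 1" by (simp add: ord)
  have R: "R = int l * int m" unfolding R_def m_def by (simp add: r)
  have cop: "coprime (int m) (int l)"
    using \<open>coprime l p\<close> by (simp add: m_def coprime_commute)
  have coprime_1_add: "coprime x (1 + x * y)" for x y :: int
    by (rule coprimeI) (use dvd_add_left_iff dvd_mult2 in blast)
  \<comment> \<open>As m divides R, both \<open>kap\<close> and \<open>q\<close> are 1 modulo
    m.\<close>
  have copk: "coprime (int m) kap"
  proof -
    have "kap = 1 + int m * (2 * int l * (R + 1))"
      by (simp add: kap_def R power2_eq_square algebra_simps)
    then show ?thesis by (simp only: coprime_1_add)
  qed
  have copq: "coprime (int m) q"
  proof -
    have "q = 1 + int m * (2 * int l)" by (simp add: q_def R)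
    then show ?thesis by (simp only: coprime_1_add)
  qed
  have "\<exists>N>0. (\<Sum>t\<in>{0..<int m}. \<omega> powi (t\<^sup>2)) ^ card C * (\<Sum>t\<in>{0..<int m}. \<omega> powi (- t\<^sup>2)) = of_nat N"
  proof (rule gauss_sum_power_positive[OF _ ord2 sq])
    show "\<omega> powi (R * (R * s - 2 * t)) = 1" for s t
      unfolding ord by (simp add: R)
  next
    fix F d s S S2 :: int
    assume e1: "q * kap * d = int m * S - q * R * s"
      and e2: "kap * R * F = (int m)\<^sup>2 * S2 - kap * (R + 1) * d\<^sup>2 + R\<^sup>2 * s\<^sup>2"
    have "q * kap * d = int m * (S - q * int l * s)" unfolding e1 by (simp add: R algebra_simps)
    then have "int m dvd q * kap * d" by simp
    then have "int m dvd d"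
      using copq copk by (simp add: coprime_dvd_mult_right_iff mult.assoc)
    then obtain w where w: "d = int m * w" by (elim dvdE)
    \<comment> \<open>The right side of \<open>e2\<close> carries m^2, whereas \<open>R\<close>
      supplies only one explicit factor m on the left. Cancelling it leaves m dividing l kap F,
      hence F.\<close>
    have "int m * (int l * kap * F) = int m * (int m * (S2 - kap * (R + 1) * w\<^sup>2 + (int l)\<^sup>2 * s\<^sup>2))"
    proof -
      have "int m * (int l * kap * F) = kap * R * F" by (simp add: R)
      then show ?thesis unfolding e2 by (simp add: w R power2_eq_square algebra_simps)
    qed
    then have "int l * kap * F = int m * (S2 - kap * (R + 1) * w\<^sup>2 + (int l)\<^sup>2 * s\<^sup>2)"
      using \<open>m > 0\<close> by simp
    then have "int m dvd int l * kap * F" by simp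
    then show "\<omega> powi F = 1"
      unfolding ord using cop copk by (simp add: coprime_dvd_mult_right_iff mult.assoc)
  qed (use \<open>m > 0\<close> in simp)
  moreover define g where "g = (\<Sum>t\<in>{0..<int m}. \<omega> powi (t\<^sup>2))"
  moreover define g' where "g' = (\<Sum>t\<in>{0..<int m}. \<omega> powi (- t\<^sup>2))"
  ultimately obtain N where N: "N > 0" "g ^ card C * g' = of_nat N" by auto
  have gg: "g * g' = of_nat m"
    unfolding g_def g'_def using gauss_sum_mult_cnj[OF _ ord2 sq] \<open>m > 0\<close> by simp
  have "g + g' = 0"
    using gauss_sum_odd_prime_power_imaginary[OF p, of \<omega> f] ord by (simp add: g_def g'_def m_def)
  then have "g' = - g" by (simp add: eq_neg_iff_add_eq_0 add.commute)
  then have g2: "g\<^sup>2 = - complex_of_real (real m)"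
    using gg by (simp add: power2_eq_square minus_equation_iff)
  have "card C = 2 * (r * (2 * r + 1)) + 1"
    unfolding card_C by (simp add: power2_eq_square algebra_simps)
  then have "g ^ card C * g' = (g\<^sup>2) ^ (r * (2 * r + 1)) * (g * g')"
    by (simp only: power_add power_mult[of g 2] power_one_right mult.assoc)
  then have "of_nat N = (- complex_of_real (real m)) ^ (r * (2 * r + 1)) * complex_of_real (real m)"
    using N(2) by (simp add: g2 gg)
  then show False
    using of_nat_neq_neg_power_mult[of N "real m" "real m" "r * (2 * r + 1)"] N(1) odd \<open>m > 0\<close> by simp
qed

end

section \<open>Translation into the parameter \<open>r\<close> and conclusion\<close>

theorem theorem6p1:
  fixes q v k lam mu m_minus :: nat and E :: "nat \<Rightarrow> nat \<Rightarrow> bool"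
    and e_plus e_minus :: real
  assumes q_gt: "q > 1" and q_odd: "odd q"
    and v_def: "v = (q + 1) * (q\<^sup>2 - q + 1)"
    and srg: "strongly_regular v E k lam mu"
    and prim: "primitive_srg v E"
    and ep_def: "e_plus = (real q - 1) / 2"
    and em_def: "e_minus = - ((real q)\<^sup>2 + 1) / 2"
    and eigs: "{e. eigenvalue (adj_matrix v E) e} = {real k, e_plus, e_minus}"
    and order_eigs: "real k \<ge> e_plus" "e_plus \<ge> 0" "0 > e_minus"
    and mult: "m_minus = eig_mult (adj_matrix v E) e_minus"
    and mult_cond: "real v * e_minus = real m_minus * (e_minus - real k)"
  shows "((q mod 8 = 5 \<or>
           (\<exists>l p e. q = 2 * l * p ^ e + 1 \<and> prime p \<and> p mod 4 = 3 \<and>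
                    e > 0 \<and> odd e \<and> odd l \<and> gcd l p = 1))
          \<longrightarrow> \<not> (\<exists>C. delsarte_coclique v E k e_minus C))
       \<and> (q > 3 \<longrightarrow> card {C. delsarte_coclique v E k e_minus C} \<le> 2)"
proof -
  obtain r where q: "q = 2 * r + 1" using q_odd by (elim oddE)
  have "r > 0" using q_gt q by simp
  have "q\<^sup>2 - q + 1 = 4 * r\<^sup>2 + 2 * r + 1"
    by (simp add: q power2_eq_square algebra_simps)
  then have v: "v = (2 * r + 2) * (4 * r\<^sup>2 + 2 * r + 1)" by (simp add: v_def q)
  define \<kappa> where "\<kappa> = 2 * (real r)\<^sup>2 + 2 * real r + 1"
  have ep: "e_plus = real r" by (simp add: ep_def q)
  have em: "e_minus = - \<kappa>" by (simp add: em_def q \<kappa>_def power2_eq_square field_simps)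
  have ev: "eigenvalue (adj_matrix v E) (real r)" "eigenvalue (adj_matrix v E) (- \<kappa>)"
    using eigs ep em by auto
  have "real v * \<kappa> = real (eig_mult (adj_matrix v E) (- \<kappa>)) * (\<kappa> + real k)"
    using mult_cond unfolding mult em by (simp add: algebra_simps)
  note params = taylor_parameters[OF \<open>r > 0\<close> v srg ev[unfolded \<kappa>_def] this[unfolded \<kappa>_def]]
  interpret G: taylor_graph v r lam E
    using \<open>r > 0\<close> v srg params by unfold_locales simp_all
  \<comment> \<open>Since \<kappa> + k = (2r + 2) \<kappa>, the Delsarte size is v / (2r + 2), that
    is q^2 - q + 1.\<close>
  have coc: "taylor_coclique v r lam E C" if "delsarte_coclique v E k e_minus C" for C
  proof
    show "coclique v E C" using that by (simp add: delsarte_coclique_def)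
    have k: "real k = (2 * real r + 1) * \<kappa>" by (simp add: params(1) \<kappa>_def algebra_simps)
    have "\<kappa> > 0" by (simp add: \<kappa>_def add_nonneg_pos)
    have "real (card C) = real v * (- \<kappa>) / (- \<kappa> - real k)"
      using that by (simp add: delsarte_coclique_def em)
    also have "\<dots> = (real v * \<kappa>) / ((2 * real r + 2) * \<kappa>)"
    proof -
      have "- \<kappa> - real k = - ((2 * real r + 2) * \<kappa>)" unfolding k by (simp add: algebra_simps)
      then show ?thesis by simp
    qed
    also have "\<dots> = real v / (2 * real r + 2)" using \<open>\<kappa> > 0\<close> by simp
    also have "\<dots> = real (4 * r\<^sup>2 + 2 * r + 1)"
      using \<open>r > 0\<close> by (simp add: v field_simps)
    finally show "card C = 4 * r\<^sup>2 + 2 * r + 1" by (simp only: of_nat_eq_iff)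
  qed
  show ?thesis
  proof (intro conjI impI)
    assume "q mod 8 = 5 \<or> (\<exists>l p e. q = 2 * l * p ^ e + 1 \<and> prime p \<and> p mod 4 = 3 \<and>
        e > 0 \<and> odd e \<and> odd l \<and> gcd l p = 1)"
    then show "\<not> (\<exists>C. delsarte_coclique v E k e_minus C)"
    proof (elim disjE exE conjE)
      assume "q mod 8 = 5"
      \<comment> \<open>Case (a) in terms of r = (q - 1)/2.\<close>
      then have "r mod 4 = 2" unfolding q by presburger
      then show ?thesis using taylor_coclique.r_mod_4_neq_2[OF coc] by blast
    next
      fix l p e
      assume *: "q = 2 * l * p ^ e + 1" "prime p" "p mod 4 = 3" "odd e" "odd l" "gcd l p = 1"
      then obtain f where "e = 2 * f + 1" by (elim oddE)
      then have "r = l * p ^ (2 * f + 1)" using *(1) q by simp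
      then show ?thesis
        using taylor_coclique.r_neq_odd_prime_power_multiple[OF coc *(2,3,5)] *(6)
        by (auto simp: coprime_iff_gcd_eq_1)
    qed
  next
    assume "q > 3"
    \<comment> \<open>For q > 3 we have r > 1, so there is in fact at most one Delsarte coclique;
      the bound 2 follows.\<close>
    then have "C = C'" if "delsarte_coclique v E k e_minus C" "delsarte_coclique v E k e_minus C'" for C C'
      using G.two_cocliques_imp_r_eq_1[OF coc[OF that(1)] coc[OF that(2)]] q by auto
    then have "\<exists>C. {C. delsarte_coclique v E k e_minus C} \<subseteq> {C}" by blast
    then obtain C where "{C. delsarte_coclique v E k e_minus C} \<subseteq> {C}" by blast
    then have "card {C. delsarte_coclique v E k e_minus C} \<le> card {C}" by (intro card_mono) auto
    then show "card {C. delsarte_coclique v E k e_minus C} \<le> 2" by simp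
  qed
qed

end
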